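(* Let $(\mathcal{M},\otimes,\mathbb{I})$ be a monoidal category and let $G$ be a monoid with neutral element $e$. Assume that $\mathcal{M}$ has an initial object $\mathbf{0}$ and coproducts indexed by $S_g:=\{(a,b)\in G\times G\mid ab=g\}$ for every $g\in G$, and that $\otimes$ preserves them. Assume further that the initial object $\mathbf{0}$ is also terminal (i.e. a zero object). Then, if $\mathcal{M}$ is pre-rigid, so is the category $\mathcal{M}^G$ of externally $G$-graded $\mathcal{M}$-objects. Explicitly, the pre-dual of $X=(X_g)_{g\in G}$ is defined by setting $(X^* )_g:=\big(\bigoplus_{h\in G,\,gh=e}X_h\big)^*$.
   Context: A monoidal category $(\mathcal{C},\otimes,\mathbb{I})$ is (right) pre-rigid if for every object $X$ there are an object $X^*$ (a pre-dual of $X$) and a morphism $\mathrm{ev}_X:X^*\otimes X\to\mathbb{I}$ such that for every object $T$ the map $\mathrm{Hom}_{\mathcal{C}}(T,X^* )\to\mathrm{Hom}_{\mathcal{C}}(T\otimes X,\mathbb{I})$, $u\mapsto \mathrm{ev}_X\circ(u\otimes X)$, is bijective. Here $X$ also denotes the identity morphism of $X$. No braiding is assumed. "$\otimes$ preserves them" means that, in each argument, $\otimes$ preserves the initial object and the coproducts indexed by the sets $S_g$. Under these hypotheses the category $\mathcal{M}^G$ is defined as follows: objects are families $(X_g)_{g\in G}$ of objects of $\mathcal{M}$, morphisms are families $(f_g)_{g\in G}$ of morphisms $f_g:X_g\to Y_g$ of $\mathcal{M}$. It is monoidal with $(X\otimes Y)_g:=\bigoplus_{(a,b)\in S_g}X_a\otimes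 Y_b$ ($\bigoplus$ denotes the coproduct) and unit $\mathbb{I}^G:=(\delta_{g,e}\mathbb{I})_{g\in G}$, where $\delta_{g,e}\mathbb{I}=\mathbb{I}$ if $g=e$ and $\mathbf{0}$ otherwise. An empty coproduct is $\mathbf{0}$. *)

theory Defs
  imports Main
begin

text \<open>Composition is written in the usual order: \<open>g \<cdot> f\<close> is \<open>g\<close> after \<open>f\<close>. Every arrow determines
  its domain and codomain; the operations are only constrained on objects and composable arrows.\<close>

record ('o, 'm) precategory =
  Ob   :: "'o set"
  Ar   :: "'m set"
  Dom  :: "'m \<Rightarrow> 'o"
  Cod  :: "'m \<Rightarrow> 'o"
  Id   :: "'o \<Rightarrow> 'm"
  Comp :: "'m \<Rightarrow> 'm \<Rightarrow> 'm"  (infixr "\<cdot>\<index>" 70)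

definition Hom :: "('o, 'm, 'x) precategory_scheme \<Rightarrow> 'o \<Rightarrow> 'o \<Rightarrow> 'm set" where
  "Hom C X Y = {f \<in> Ar C. Dom C f = X \<and> Cod C f = Y}"

locale category =
  fixes C :: "('o, 'm, 'x) precategory_scheme" (structure)
  assumes Dom_Ob: "f \<in> Ar C \<Longrightarrow> Dom C f \<in> Ob C"
    and Cod_Ob: "f \<in> Ar C \<Longrightarrow> Cod C f \<in> Ob C"
    and Id_Hom: "X \<in> Ob C \<Longrightarrow> Id C X \<in> Hom C X X"
    and Comp_Hom: "\<lbrakk>f \<in> Hom C X Y; g \<in> Hom C Y Z\<rbrakk> \<Longrightarrow> g \<cdot> f \<in> Hom C X Z"
    and Comp_Id_left: "f \<in> Hom C X Y \<Longrightarrow> Id C Y \<cdot> f = f"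
    and Comp_Id_right: "f \<in> Hom C X Y \<Longrightarrow> f \<cdot> Id C X = f"
    and Comp_assoc:
      "\<lbrakk>f \<in> Hom C W X; g \<in> Hom C X Y; h \<in> Hom C Y Z\<rbrakk> \<Longrightarrow> (h \<cdot> g) \<cdot> f = h \<cdot> (g \<cdot> f)"

definition Iso :: "('o, 'm, 'x) precategory_scheme \<Rightarrow> 'o \<Rightarrow> 'o \<Rightarrow> 'm set" where
  "Iso C X Y = {f \<in> Hom C X Y. \<exists>g \<in> Hom C Y X. g \<cdot>\<^bsub>C\<^esub> f = Id C X \<and> f \<cdot>\<^bsub>C\<^esub> g = Id C Y}"

definition is_initial :: "('o, 'm, 'x) precategory_scheme \<Rightarrow> 'o \<Rightarrow> bool" where
  "is_initial C Z \<longleftrightarrow> Z \<in> Ob C \<and> (\<forall>Y \<in> Ob C. \<exists>!u. u \<in> Hom C Z Y)"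

definition is_terminal :: "('o, 'm, 'x) precategory_scheme \<Rightarrow> 'o \<Rightarrow> bool" where
  "is_terminal C Z \<longleftrightarrow> Z \<in> Ob C \<and> (\<forall>Y \<in> Ob C. \<exists>!u. u \<in> Hom C Y Z)"

text \<open>Families indexed by a set \<open>J\<close> are total functions of which only the values on \<open>J\<close> matter.\<close>

definition is_coproduct ::
    "('o, 'm, 'x) precategory_scheme \<Rightarrow> 'i set \<Rightarrow> ('i \<Rightarrow> 'o) \<Rightarrow> 'o \<Rightarrow> ('i \<Rightarrow> 'm) \<Rightarrow> bool" where
  "is_coproduct C J X K \<iota> \<longleftrightarrow>
     K \<in> Ob C \<and> (\<forall>j \<in> J. \<iota> j \<in> Hom C (X j) K) \<and>
     (\<forall>Y \<in> Ob C. \<forall>f. (\<forall>j \<in> J. f j \<in> Hom C (X j) Y) \<longrightarrow>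
        (\<exists>!u. u \<in> Hom C K Y \<and> (\<forall>j \<in> J. u \<cdot>\<^bsub>C\<^esub> \<iota> j = f j)))"

record ('o, 'm) premonoidal = "('o, 'm) precategory" +
  TensOb :: "'o \<Rightarrow> 'o \<Rightarrow> 'o"  (infixr "\<otimes>\<index>" 75)
  TensAr :: "'m \<Rightarrow> 'm \<Rightarrow> 'm"  (infixr "\<boxtimes>\<index>" 75)
  Unit   :: "'o"
  Assoc  :: "'o \<Rightarrow> 'o \<Rightarrow> 'o \<Rightarrow> 'm"
  LUnit  :: "'o \<Rightarrow> 'm"
  RUnit  :: "'o \<Rightarrow> 'm"

locale monoidal_category = category C
  for C :: "('o, 'm, 'x) premonoidal_scheme" (structure) +
  assumes Unit_Ob: "Unit C \<in> Ob C"
    and Tens_Ob: "\<lbrakk>X \<in> Ob C; Y \<in> Ob C\<rbrakk> \<Longrightarrow> X \<otimes> Y \<in> Ob C"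
    and Tens_Hom: "\<lbrakk>f \<in> Hom C X X'; g \<in> Hom C Y Y'\<rbrakk> \<Longrightarrow> f \<boxtimes> g \<in> Hom C (X \<otimes> Y) (X' \<otimes> Y')"
    and Tens_Id: "\<lbrakk>X \<in> Ob C; Y \<in> Ob C\<rbrakk> \<Longrightarrow> Id C X \<boxtimes> Id C Y = Id C (X \<otimes> Y)"
    and Tens_Comp:
      "\<lbrakk>f \<in> Hom C X X'; f' \<in> Hom C X' X''; g \<in> Hom C Y Y'; g' \<in> Hom C Y' Y''\<rbrakk>
       \<Longrightarrow> (f' \<cdot> f) \<boxtimes> (g' \<cdot> g) = (f' \<boxtimes> g') \<cdot> (f \<boxtimes> g)"
    and Assoc_Iso:
      "\<lbrakk>X \<in> Ob C; Y \<in> Ob C; Z \<in> Ob C\<rbrakk> \<Longrightarrow> Assoc C X Y Z \<in> Iso C ((X \<otimes> Y) \<otimes> Z) (X \<otimes> (Y \<otimes> Z))"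
    and Assoc_natural:
      "\<lbrakk>f \<in> Hom C X X'; g \<in> Hom C Y Y'; h \<in> Hom C Z Z'\<rbrakk>
       \<Longrightarrow> Assoc C X' Y' Z' \<cdot> ((f \<boxtimes> g) \<boxtimes> h) = (f \<boxtimes> (g \<boxtimes> h)) \<cdot> Assoc C X Y Z"
    and LUnit_Iso: "X \<in> Ob C \<Longrightarrow> LUnit C X \<in> Iso C (Unit C \<otimes> X) X"
    and LUnit_natural: "f \<in> Hom C X X' \<Longrightarrow> LUnit C X' \<cdot> (Id C (Unit C) \<boxtimes> f) = f \<cdot> LUnit C X"
    and RUnit_Iso: "X \<in> Ob C \<Longrightarrow> RUnit C X \<in> Iso C (X \<otimes> Unit C) X"
    and RUnit_natural: "f \<in> Hom C X X' \<Longrightarrow> RUnit C X' \<cdot> (f \<boxtimes> Id C (Unit C)) = f \<cdot> RUnit C X"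
    and triangle:
      "\<lbrakk>X \<in> Ob C; Y \<in> Ob C\<rbrakk>
       \<Longrightarrow> (Id C X \<boxtimes> LUnit C Y) \<cdot> Assoc C X (Unit C) Y = RUnit C X \<boxtimes> Id C Y"
    and pentagon:
      "\<lbrakk>W \<in> Ob C; X \<in> Ob C; Y \<in> Ob C; Z \<in> Ob C\<rbrakk>
       \<Longrightarrow> (Id C W \<boxtimes> Assoc C X Y Z) \<cdot> (Assoc C W (X \<otimes> Y) Z \<cdot> (Assoc C W X Y \<boxtimes> Id C Z))
           = Assoc C W X (Y \<otimes> Z) \<cdot> Assoc C (W \<otimes> X) Y Z"

definition is_predual :: "('o, 'm, 'x) premonoidal_scheme \<Rightarrow> 'o \<Rightarrow> 'o \<Rightarrow> 'm \<Rightarrow> bool" where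
  "is_predual C X D ev \<longleftrightarrow>
     D \<in> Ob C \<and> ev \<in> Hom C (D \<otimes>\<^bsub>C\<^esub> X) (Unit C) \<and>
     (\<forall>T \<in> Ob C. bij_betw (\<lambda>u. ev \<cdot>\<^bsub>C\<^esub> (u \<boxtimes>\<^bsub>C\<^esub> Id C X))
                   (Hom C T D) (Hom C (T \<otimes>\<^bsub>C\<^esub> X) (Unit C)))"

locale pre_rigid = monoidal_category C
  for C :: "('o, 'm, 'x) premonoidal_scheme" (structure) +
  assumes has_predual: "X \<in> Ob C \<Longrightarrow> \<exists>D ev. is_predual C X D ev"

definition tensor_preserves_initial :: "('o, 'm, 'x) premonoidal_scheme \<Rightarrow> bool" where
  "tensor_preserves_initial C \<longleftrightarrow>
     (\<forall>Z Y. is_initial C Z \<and> Y \<in> Ob C \<longrightarrow> is_initial C (Y \<otimes>\<^bsub>C\<^esub> Z) \<and> is_initial C (Z \<otimes>\<^bsub>C\<^esub> Y))"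

definition tensor_preserves_coproducts ::
    "('o, 'm, 'x) premonoidal_scheme \<Rightarrow> 'i set \<Rightarrow> bool" where
  "tensor_preserves_coproducts C J \<longleftrightarrow>
     (\<forall>X K \<iota> Y. is_coproduct C J X K \<iota> \<and> Y \<in> Ob C \<longrightarrow>
        is_coproduct C J (\<lambda>j. Y \<otimes>\<^bsub>C\<^esub> X j) (Y \<otimes>\<^bsub>C\<^esub> K) (\<lambda>j. Id C Y \<boxtimes>\<^bsub>C\<^esub> \<iota> j) \<and>
        is_coproduct C J (\<lambda>j. X j \<otimes>\<^bsub>C\<^esub> Y) (K \<otimes>\<^bsub>C\<^esub> Y) (\<lambda>j. \<iota> j \<boxtimes>\<^bsub>C\<^esub> Id C Y))"

definition factorizations :: "'g::monoid_mult \<Rightarrow> ('g \<times> 'g) set" where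
  "factorizations g = {(a, b). a * b = g}"

text \<open>The externally graded category depends on a chosen initial object \<open>z\<close> and on chosen coproducts
  indexed by the sets of factorizations: \<open>cop g X\<close> with injections \<open>inc g X\<close> is the coproduct of the
  family \<open>X\<close> indexed by \<open>factorizations g\<close>.\<close>

type_synonym ('g, 'o) chosen_cop = "'g \<Rightarrow> ('g \<times> 'g \<Rightarrow> 'o) \<Rightarrow> 'o"
type_synonym ('g, 'o, 'm) chosen_inc = "'g \<Rightarrow> ('g \<times> 'g \<Rightarrow> 'o) \<Rightarrow> 'g \<times> 'g \<Rightarrow> 'm"

definition graded_summand ::
    "('o, 'm) premonoidal \<Rightarrow> ('g \<Rightarrow> 'o) \<Rightarrow> ('g \<Rightarrow> 'o) \<Rightarrow> 'g \<times> 'g \<Rightarrow> 'o" where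
  "graded_summand M X Y = (\<lambda>(a, b). X a \<otimes>\<^bsub>M\<^esub> Y b)"

definition graded_tens ::
    "('o, 'm) premonoidal \<Rightarrow> ('g, 'o) chosen_cop \<Rightarrow> ('g \<Rightarrow> 'o) \<Rightarrow> ('g \<Rightarrow> 'o) \<Rightarrow> 'g \<Rightarrow> 'o" where
  "graded_tens M cop X Y = (\<lambda>g. cop g (graded_summand M X Y))"

definition graded_inj ::
    "('o, 'm) premonoidal \<Rightarrow> ('g::monoid_mult, 'o, 'm) chosen_inc
     \<Rightarrow> ('g \<Rightarrow> 'o) \<Rightarrow> ('g \<Rightarrow> 'o) \<Rightarrow> 'g \<Rightarrow> 'g \<Rightarrow> 'm" where
  "graded_inj M inc X Y a b = inc (a * b) (graded_summand M X Y) (a, b)"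

definition graded_unit :: "('o, 'm) premonoidal \<Rightarrow> 'o \<Rightarrow> 'g::monoid_mult \<Rightarrow> 'o" where
  "graded_unit M z = (\<lambda>g. if g = 1 then Unit M else z)"

text \<open>The remaining structure morphisms are the unique ones compatible with the coproduct
  injections. For the associator, \<open>((X \<otimes> Y) \<otimes> Z) g\<close> is the coproduct of the
  \<open>(X a \<otimes> Y b) \<otimes> Z c\<close> over \<open>a * b * c = g\<close> because the tensor product preserves the coproducts. For
  the unitors, the summands \<open>z \<otimes> X b\<close> and \<open>X a \<otimes> z\<close> are initial, so that a single injection
  determines the morphism.\<close>

definition graded_tens_ar ::
    "('o, 'm) premonoidal \<Rightarrow> ('g::monoid_mult, 'o) chosen_cop \<Rightarrow> ('g, 'o, 'm) chosen_inc
     \<Rightarrow> ('g \<Rightarrow> 'm) \<Rightarrow> ('g \<Rightarrow> 'm) \<Rightarrow> 'g \<Rightarrow> 'm" where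
  "graded_tens_ar M cop inc f h = (\<lambda>g.
     let X = \<lambda>a. Dom M (f a); X' = \<lambda>a. Cod M (f a); Y = \<lambda>b. Dom M (h b); Y' = \<lambda>b. Cod M (h b)
     in THE u. u \<in> Hom M (graded_tens M cop X Y g) (graded_tens M cop X' Y' g) \<and>
          (\<forall>a b. a * b = g \<longrightarrow>
             u \<cdot>\<^bsub>M\<^esub> graded_inj M inc X Y a b = graded_inj M inc X' Y' a b \<cdot>\<^bsub>M\<^esub> (f a \<boxtimes>\<^bsub>M\<^esub> h b)))"

definition graded_assoc ::
    "('o, 'm) premonoidal \<Rightarrow> ('g::monoid_mult, 'o) chosen_cop \<Rightarrow> ('g, 'o, 'm) chosen_inc
     \<Rightarrow> ('g \<Rightarrow> 'o) \<Rightarrow> ('g \<Rightarrow> 'o) \<Rightarrow> ('g \<Rightarrow> 'o) \<Rightarrow> 'g \<Rightarrow> 'm" where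
  "graded_assoc M cop inc X Y Z = (\<lambda>g.
     let XY = graded_tens M cop X Y; YZ = graded_tens M cop Y Z
     in THE u. u \<in> Hom M (graded_tens M cop XY Z g) (graded_tens M cop X YZ g) \<and>
          (\<forall>a b c. a * b * c = g \<longrightarrow>
             u \<cdot>\<^bsub>M\<^esub> (graded_inj M inc XY Z (a * b) c \<cdot>\<^bsub>M\<^esub> (graded_inj M inc X Y a b \<boxtimes>\<^bsub>M\<^esub> Id M (Z c)))
             = graded_inj M inc X YZ a (b * c) \<cdot>\<^bsub>M\<^esub>
                 ((Id M (X a) \<boxtimes>\<^bsub>M\<^esub> graded_inj M inc Y Z b c) \<cdot>\<^bsub>M\<^esub> Assoc M (X a) (Y b) (Z c))))"

definition graded_lunit ::
    "('o, 'm) premonoidal \<Rightarrow> 'o \<Rightarrow> ('g::monoid_mult, 'o) chosen_cop \<Rightarrow> ('g, 'o, 'm) chosen_inc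
     \<Rightarrow> ('g \<Rightarrow> 'o) \<Rightarrow> 'g \<Rightarrow> 'm" where
  "graded_lunit M z cop inc X = (\<lambda>g.
     THE u. u \<in> Hom M (graded_tens M cop (graded_unit M z) X g) (X g) \<and>
            u \<cdot>\<^bsub>M\<^esub> graded_inj M inc (graded_unit M z) X 1 g = LUnit M (X g))"

definition graded_runit ::
    "('o, 'm) premonoidal \<Rightarrow> 'o \<Rightarrow> ('g::monoid_mult, 'o) chosen_cop \<Rightarrow> ('g, 'o, 'm) chosen_inc
     \<Rightarrow> ('g \<Rightarrow> 'o) \<Rightarrow> 'g \<Rightarrow> 'm" where
  "graded_runit M z cop inc X = (\<lambda>g.
     THE u. u \<in> Hom M (graded_tens M cop X (graded_unit M z) g) (X g) \<and>
            u \<cdot>\<^bsub>M\<^esub> graded_inj M inc X (graded_unit M z) g 1 = RUnit M (X g))"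

definition graded_category ::
    "('o, 'm) premonoidal \<Rightarrow> 'o \<Rightarrow> ('g::monoid_mult, 'o) chosen_cop \<Rightarrow> ('g, 'o, 'm) chosen_inc
     \<Rightarrow> ('g \<Rightarrow> 'o, 'g \<Rightarrow> 'm) premonoidal" where
  "graded_category M z cop inc =
     \<lparr>Ob = {X. \<forall>g. X g \<in> Ob M},
      Ar = {f. \<forall>g. f g \<in> Ar M},
      Dom = (\<lambda>f g. Dom M (f g)),
      Cod = (\<lambda>f g. Cod M (f g)),
      Id = (\<lambda>X g. Id M (X g)),
      Comp = (\<lambda>f h g. f g \<cdot>\<^bsub>M\<^esub> h g),
      TensOb = graded_tens M cop,
      TensAr = graded_tens_ar M cop inc,
      Unit = graded_unit M z,
      Assoc = graded_assoc M cop inc,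
      LUnit = graded_lunit M z cop inc,
      RUnit = graded_runit M z cop inc\<rparr>"

end

theory Submission
  imports Defs
begin

text \<open>Pairs \<open>(a, b)\<close> with \<open>a * b = 1\<close> are the only ones that matter for morphisms into the graded
  unit, because \<open>z\<close> is terminal. Let \<open>K a\<close> be the coproduct of the \<open>X b\<close> over \<open>a * b = 1\<close>. A morphism
  from \<open>T \<otimes> X\<close> to the graded unit is then a family of morphisms \<open>T a \<otimes> X b \<rightarrow> Unit M\<close> over
  \<open>a * b = 1\<close>, that is, a family \<open>T a \<otimes> K a \<rightarrow> Unit M\<close>, that is, a family from \<open>T a\<close> to the
  pre-dual of \<open>K a\<close>.
  The monoidal axioms are tested on the injections of iterated coproducts, where they reduce to the
  axioms of \<open>M\<close>.\<close>

section \<open>Composition and isomorphisms\<close>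

text \<open>The obstacle lies in the index sets. Coproducts, and their preservation by the tensor
  product, are given over full sets of factorizations, whereas a tensor product with the graded unit
  should have a single summand and \<open>K a\<close> is indexed by the right inverses of
  \<open>a\<close>. One remark closes both gaps: initial summands may be dropped from a coproduct or
  added to it without changing the object. The structure arrows of the graded category are definite
  descriptions, so nothing can be computed with them before existence and uniqueness are
  established; afterwards they are handled through their typing and their values on injections.
  Triples \<open>(a, b, c)\<close> serve as indices instead of nested pairs, so that both
  bracketings of a threefold product share one index set.\<close>

lemma Hom_iff: "f \<in> Hom C X Y \<longleftrightarrow> f \<in> Ar C \<and> Dom C f = X \<and> Cod C f = Y"
  by (simp add: Hom_def)

context category
begin

lemma Hom_Ob: "f \<in> Hom C X Y \<Longrightarrow> X \<in> Ob C" "f \<in> Hom C X Y \<Longrightarrow> Y \<in> Ob C"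
  using Dom_Ob Cod_Ob by (auto simp: Hom_iff)

text \<open>The axioms in \<open>Hom\<close> form mention intermediate objects that are absent from
  the resulting term, so rewriting would have to guess them. With \<open>Dom\<close> and
  \<open>Cod\<close> every object is read off the arrows, and composability becomes a side condition
  for the simplifier.\<close>

lemma Comp_typing:
  assumes "f \<in> Ar C" "g \<in> Ar C" "Cod C f = Dom C g"
  shows "g \<cdot> f \<in> Ar C" "Dom C (g \<cdot> f) = Dom C f" "Cod C (g \<cdot> f) = Cod C g"
  using Comp_Hom[of f "Dom C f" "Dom C g" g "Cod C g"] assms by (auto simp: Hom_iff)

lemma Id_typing:
  assumes "X \<in> Ob C"
  shows "Id C X \<in> Ar C" "Dom C (Id C X) = X" "Cod C (Id C X) = X"
  using Id_Hom[OF assms] by (auto simp: Hom_iff)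

lemma Comp_assoc_Ar:
  assumes "f \<in> Ar C" "g \<in> Ar C" "h \<in> Ar C" "Cod C f = Dom C g" "Cod C g = Dom C h"
  shows "(h \<cdot> g) \<cdot> f = h \<cdot> (g \<cdot> f)"
  using Comp_assoc[of f "Dom C f" "Dom C g" g "Dom C h" h "Cod C h"] assms by (simp add: Hom_iff)

lemma Id_left_Ar: "\<lbrakk>f \<in> Ar C; Cod C f = Y\<rbrakk> \<Longrightarrow> Id C Y \<cdot> f = f"
  using Comp_Id_left[of f "Dom C f" Y] by (simp add: Hom_iff)

lemma Id_right_Ar: "\<lbrakk>f \<in> Ar C; Dom C f = X\<rbrakk> \<Longrightarrow> f \<cdot> Id C X = f"
  using Comp_Id_right[of f X "Cod C f"] by (simp add: Hom_iff)

lemmas composition = Comp_typing Id_typing Comp_assoc_Ar Id_left_Ar Id_right_Ar Dom_Ob Cod_Ob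

text \<open>Turns an equation between composites into a rewrite rule for right-nested composites.\<close>

lemma Comp_eq_tail:
  assumes "h \<cdot> g = k" "f \<in> Ar C" "g \<in> Ar C" "h \<in> Ar C" "Cod C f = Dom C g" "Cod C g = Dom C h"
  shows "h \<cdot> (g \<cdot> f) = k \<cdot> f"
  using assms Comp_assoc_Ar by metis

lemma Iso_Hom: "f \<in> Iso C X Y \<Longrightarrow> f \<in> Hom C X Y"
  by (simp add: Iso_def)

lemma IsoI:
  assumes "f \<in> Hom C X Y" "g \<in> Hom C Y X" "g \<cdot> f = Id C X" "f \<cdot> g = Id C Y"
  shows "f \<in> Iso C X Y"
  using assms by (auto simp: Iso_def)

lemma Iso_inverse:
  assumes "f \<in> Iso C X Y"
  obtains g where "g \<in> Hom C Y X" "g \<cdot> f = Id C X" "f \<cdot> g = Id C Y" "g \<in> Iso C Y X"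
  using assms by (auto simp: Iso_def)

text \<open>Necessarily \<open>u\<close> is \<open>f\<close> after the inverse of \<open>i\<close>.
  This is how an arrow known only through its composite with an invertible injection is seen to be
  invertible.\<close>

lemma Iso_cancel_left:
  assumes i: "i \<in> Iso C A K" and f: "f \<in> Iso C A B" and u: "u \<in> Hom C K B" "u \<cdot> i = f"
  shows "u \<in> Iso C K B"
proof -
  obtain i' where i': "i' \<in> Hom C K A" "i' \<cdot> i = Id C A" "i \<cdot> i' = Id C K"
    using Iso_inverse[OF i] by blast
  obtain f' where f': "f' \<in> Hom C B A" "f' \<cdot> f = Id C A" "f \<cdot> f' = Id C B"
    using Iso_inverse[OF f] by blast
  have ih: "i \<in> Hom C A K" and fh: "f \<in> Hom C A B"
    using Iso_Hom i f by auto
  have "u = u \<cdot> (i \<cdot> i')"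
    using Comp_Id_right[OF u(1)] i'(3) by simp
  also have "\<dots> = f \<cdot> i'"
    using Comp_assoc[OF i'(1) ih u(1)] u(2) by simp
  finally have u_eq: "u = f \<cdot> i'" .
  show ?thesis
  proof (rule IsoI[OF u(1), of "i \<cdot> f'"])
    show "i \<cdot> f' \<in> Hom C B K"
      using Comp_Hom f'(1) ih by blast
    show "u \<cdot> (i \<cdot> f') = Id C B"
      using Comp_assoc[OF f'(1) ih u(1)] u(2) f'(3) by simp
    have "(i \<cdot> f') \<cdot> (f \<cdot> i') = i \<cdot> ((f' \<cdot> f) \<cdot> i')"
      using ih fh i'(1) f'(1) by (auto simp: Hom_iff composition)
    then show "(i \<cdot> f') \<cdot> u = Id C K"
      using u_eq f'(2) i' Comp_Id_left by simp
  qed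
qed

lemma initial_ext: "\<lbrakk>is_initial C Z; u \<in> Hom C Z Y; v \<in> Hom C Z Y\<rbrakk> \<Longrightarrow> u = v"
  using Hom_Ob(2) unfolding is_initial_def by blast

lemma terminal_ext: "\<lbrakk>is_terminal C Z; u \<in> Hom C Y Z; v \<in> Hom C Y Z\<rbrakk> \<Longrightarrow> u = v"
  using Hom_Ob(1) unfolding is_terminal_def by blast

section \<open>Coproducts\<close>

lemma coproduct_Ob: "is_coproduct C J X K \<iota> \<Longrightarrow> K \<in> Ob C"
  by (simp add: is_coproduct_def)

lemma coproduct_inj: "\<lbrakk>is_coproduct C J X K \<iota>; j \<in> J\<rbrakk> \<Longrightarrow> \<iota> j \<in> Hom C (X j) K"
  by (simp add: is_coproduct_def)

lemma coproduct_factor: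
  assumes "is_coproduct C J X K \<iota>" "Y \<in> Ob C" "\<And>j. j \<in> J \<Longrightarrow> f j \<in> Hom C (X j) Y"
  obtains u where "u \<in> Hom C K Y" "\<And>j. j \<in> J \<Longrightarrow> u \<cdot> \<iota> j = f j"
  using assms unfolding is_coproduct_def by blast

lemma coproduct_ext:
  assumes cop: "is_coproduct C J X K \<iota>" and u: "u \<in> Hom C K Y" and v: "v \<in> Hom C K Y"
    and eq: "\<And>j. j \<in> J \<Longrightarrow> u \<cdot> \<iota> j = v \<cdot> \<iota> j"
  shows "u = v"
proof -
  have univ: "\<forall>f. (\<forall>j \<in> J. f j \<in> Hom C (X j) Y) \<longrightarrow>
      (\<exists>!w. w \<in> Hom C K Y \<and> (\<forall>j \<in> J. w \<cdot> \<iota> j = f j))"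
    using cop Hom_Ob(2)[OF v] by (simp add: is_coproduct_def)
  have "\<forall>j \<in> J. v \<cdot> \<iota> j \<in> Hom C (X j) Y"
    using coproduct_inj[OF cop] v Comp_Hom by blast
  then have "\<exists>!w. w \<in> Hom C K Y \<and> (\<forall>j \<in> J. w \<cdot> \<iota> j = v \<cdot> \<iota> j)"
    using univ[THEN spec, of "\<lambda>j. v \<cdot> \<iota> j"] by (rule mp[rotated])
  moreover have "\<forall>j \<in> J. u \<cdot> \<iota> j = v \<cdot> \<iota> j"
    using eq by blast
  ultimately show ?thesis
    using u v by blast
qed

lemma coproductI:
  assumes "K \<in> Ob C" "\<And>j. j \<in> J \<Longrightarrow> \<iota> j \<in> Hom C (X j) K"
    and "\<And>Y f. \<lbrakk>Y \<in> Ob C; \<And>j. j \<in> J \<Longrightarrow> f j \<in> Hom C (X j) Y\<rbrakk>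
           \<Longrightarrow> \<exists>u \<in> Hom C K Y. \<forall>j \<in> J. u \<cdot> \<iota> j = f j"
    and "\<And>Y u v. \<lbrakk>u \<in> Hom C K Y; v \<in> Hom C K Y; \<And>j. j \<in> J \<Longrightarrow> u \<cdot> \<iota> j = v \<cdot> \<iota> j\<rbrakk> \<Longrightarrow> u = v"
  shows "is_coproduct C J X K \<iota>"
  unfolding is_coproduct_def
proof (intro conjI ballI allI impI)
  fix Y f assume Y: "Y \<in> Ob C" and f: "\<forall>j \<in> J. f j \<in> Hom C (X j) Y"
  obtain u where u: "u \<in> Hom C K Y" "\<forall>j \<in> J. u \<cdot> \<iota> j = f j"
    using assms(3)[OF Y] f by blast
  show "\<exists>!u. u \<in> Hom C K Y \<and> (\<forall>j \<in> J. u \<cdot> \<iota> j = f j)"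
    using u assms(4) by (intro ex1I[of _ u]) auto
qed (use assms(1,2) in auto)

lemma coproduct_cong:
  assumes "is_coproduct C J X K \<iota>" "\<And>j. j \<in> J \<Longrightarrow> X j = X' j" "\<And>j. j \<in> J \<Longrightarrow> \<iota> j = \<iota>' j"
  shows "is_coproduct C J X' K \<iota>'"
  using assms unfolding is_coproduct_def by simp

lemma coproduct_reindex:
  assumes cop: "is_coproduct C J X K \<iota>" and \<phi>: "bij_betw \<phi> I J"
  shows "is_coproduct C I (\<lambda>i. X (\<phi> i)) K (\<lambda>i. \<iota> (\<phi> i))"
proof (rule coproductI)
  show "K \<in> Ob C"
    using coproduct_Ob[OF cop] .
  show "\<iota> (\<phi> i) \<in> Hom C (X (\<phi> i)) K" if "i \<in> I" for i
    using coproduct_inj[OF cop] bij_betwE[OF \<phi>] that by blast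
  show "u = v" if "u \<in> Hom C K Y" "v \<in> Hom C K Y" "\<And>i. i \<in> I \<Longrightarrow> u \<cdot> \<iota> (\<phi> i) = v \<cdot> \<iota> (\<phi> i)" for Y u v
    using coproduct_ext[OF cop that(1,2)] that(3) \<phi> unfolding bij_betw_def by blast
next
  fix Y f assume Y: "Y \<in> Ob C" and f: "\<And>i. i \<in> I \<Longrightarrow> f i \<in> Hom C (X (\<phi> i)) Y"
  have "f (the_inv_into I \<phi> j) \<in> Hom C (X j) Y" if "j \<in> J" for j
    using f[of "the_inv_into I \<phi> j"] that \<phi>
    by (metis bij_betwE bij_betw_the_inv_into f_the_inv_into_f_bij_betw)
  then obtain u where "u \<in> Hom C K Y" "\<And>j. j \<in> J \<Longrightarrow> u \<cdot> \<iota> j = f (the_inv_into I \<phi> j)"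
    using coproduct_factor[OF cop Y, of "\<lambda>j. f (the_inv_into I \<phi> j)"] by blast
  moreover have "the_inv_into I \<phi> (\<phi> i) = i" if "i \<in> I" for i
    using \<phi> that by (simp add: bij_betw_def the_inv_into_f_f)
  ultimately show "\<exists>u \<in> Hom C K Y. \<forall>i \<in> I. u \<cdot> \<iota> (\<phi> i) = f i"
    using bij_betwE[OF \<phi>] by (metis (no_types))
qed

text \<open>Arrows out of \<open>K\<close> are glued from arrows out of the \<open>X j\<close>, and
  each of these is in turn glued from arrows on its own summands. Iterated tensor products are
  unfolded in this way.\<close>

lemma coproduct_Sigma:
  assumes cop: "is_coproduct C J X K \<iota>"
    and cops: "\<And>j. j \<in> J \<Longrightarrow> is_coproduct C (I j) (Y j) (X j) (\<kappa> j)"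
  shows "is_coproduct C (Sigma J I) (\<lambda>(j, i). Y j i) K (\<lambda>(j, i). \<iota> j \<cdot> \<kappa> j i)"
proof (rule coproductI)
  note inj = coproduct_inj[OF cop] coproduct_inj[OF cops]
  show "K \<in> Ob C"
    using coproduct_Ob[OF cop] .
  show "(\<lambda>(j, i). \<iota> j \<cdot> \<kappa> j i) p \<in> Hom C ((\<lambda>(j, i). Y j i) p) K" if "p \<in> Sigma J I" for p
    using that inj Comp_Hom by fastforce
  show "u = v" if u: "u \<in> Hom C K W" and v: "v \<in> Hom C K W"
    and eq: "\<And>p. p \<in> Sigma J I \<Longrightarrow> u \<cdot> (\<lambda>(j, i). \<iota> j \<cdot> \<kappa> j i) p = v \<cdot> (\<lambda>(j, i). \<iota> j \<cdot> \<kappa> j i) p" for W u v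
  proof (rule coproduct_ext[OF cop u v])
    fix j assume j: "j \<in> J"
    show "u \<cdot> \<iota> j = v \<cdot> \<iota> j"
    proof (rule coproduct_ext[OF cops[OF j]])
      show "u \<cdot> \<iota> j \<in> Hom C (X j) W" "v \<cdot> \<iota> j \<in> Hom C (X j) W"
        using inj(1)[OF j] u v Comp_Hom by auto
      fix i assume i: "i \<in> I j"
      then show "(u \<cdot> \<iota> j) \<cdot> \<kappa> j i = (v \<cdot> \<iota> j) \<cdot> \<kappa> j i"
        using eq[of "(j, i)"] j Comp_assoc[OF inj(2)[OF j i] inj(1)[OF j]] u v by simp
    qed
  qed
  fix W f assume W: "W \<in> Ob C"
    and f: "\<And>p. p \<in> Sigma J I \<Longrightarrow> f p \<in> Hom C ((\<lambda>(j, i). Y j i) p) W"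
  have "\<exists>u. u \<in> Hom C (X j) W \<and> (\<forall>i \<in> I j. u \<cdot> \<kappa> j i = f (j, i))" if j: "j \<in> J" for j
  proof -
    have "f (j, i) \<in> Hom C (Y j i) W" if "i \<in> I j" for i
      using f[of "(j, i)"] j that by simp
    then show ?thesis
      by (metis coproduct_factor[OF cops[OF j] W, of "\<lambda>i. f (j, i)"])
  qed
  then obtain w where w: "\<And>j. j \<in> J \<Longrightarrow> w j \<in> Hom C (X j) W"
      "\<And>j i. \<lbrakk>j \<in> J; i \<in> I j\<rbrakk> \<Longrightarrow> w j \<cdot> \<kappa> j i = f (j, i)"
    by metis
  obtain u where u: "u \<in> Hom C K W" "\<And>j. j \<in> J \<Longrightarrow> u \<cdot> \<iota> j = w j"
    using coproduct_factor[OF cop W, of w] w(1) by blast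
  have "u \<cdot> (\<iota> j \<cdot> \<kappa> j i) = f (j, i)" if "j \<in> J" "i \<in> I j" for j i
    using Comp_assoc[OF coproduct_inj[OF cops[OF that(1)] that(2)] inj(1)[OF that(1)] u(1)]
      u(2)[OF that(1)] w(2)[OF that] by simp
  then show "\<exists>u \<in> Hom C K W. \<forall>p \<in> Sigma J I. u \<cdot> (\<lambda>(j, i). \<iota> j \<cdot> \<kappa> j i) p = f p"
    using u(1) by auto
qed

text \<open>An arrow out of an initial summand carries no information: its uniqueness makes the test
  at that index automatic, and its existence completes a cocone on \<open>I\<close> to one on
  \<open>J\<close>.\<close>

lemma coproduct_restrict:
  assumes cop: "is_coproduct C J X K \<iota>" and sub: "I \<subseteq> J"
    and init: "\<And>j. j \<in> J - I \<Longrightarrow> is_initial C (X j)"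
  shows "is_coproduct C I X K \<iota>"
proof (rule coproductI)
  show "K \<in> Ob C"
    using coproduct_Ob[OF cop] .
  show "\<iota> i \<in> Hom C (X i) K" if "i \<in> I" for i
    using coproduct_inj[OF cop] sub that by blast
  show "u = v" if u: "u \<in> Hom C K Y" and v: "v \<in> Hom C K Y"
    and eq: "\<And>i. i \<in> I \<Longrightarrow> u \<cdot> \<iota> i = v \<cdot> \<iota> i" for Y u v
  proof (rule coproduct_ext[OF cop u v])
    fix j assume j: "j \<in> J"
    show "u \<cdot> \<iota> j = v \<cdot> \<iota> j"
    proof (cases "j \<in> I")
      case False
      then show ?thesis
        using initial_ext[OF init] j coproduct_inj[OF cop j] Comp_Hom u v by blast
    qed (use eq in blast)
  qed
  fix Y f assume Y: "Y \<in> Ob C" and f: "\<And>i. i \<in> I \<Longrightarrow> f i \<in> Hom C (X i) Y"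
  \<comment> \<open>Off \<open>I\<close> the cocone takes the only arrow from the initial object
    \<open>X j\<close> to \<open>Y\<close>.\<close>
  define f' where "f' j = (if j \<in> I then f j else THE u. u \<in> Hom C (X j) Y)" for j
  have "f' j \<in> Hom C (X j) Y" if "j \<in> J" for j
  proof (cases "j \<in> I")
    case False
    then have "\<exists>!u. u \<in> Hom C (X j) Y"
      using init[of j] that Y by (auto simp: is_initial_def)
    then show ?thesis
      using theI'[of "\<lambda>u. u \<in> Hom C (X j) Y"] False by (simp add: f'_def)
  qed (use f in \<open>simp add: f'_def\<close>)
  then obtain u where "u \<in> Hom C K Y" "\<And>j. j \<in> J \<Longrightarrow> u \<cdot> \<iota> j = f' j"
    using coproduct_factor[OF cop Y] by blast
  then show "\<exists>u \<in> Hom C K Y. \<forall>i \<in> I. u \<cdot> \<iota> i = f i"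
    using sub by (intro bexI[of _ u]) (auto simp: f'_def)
qed

text \<open>At an added index, \<open>u \<cdot> \<iota> j\<close> and \<open>f j\<close> leave the
  same initial object and hence agree. The extra legs must be assumed to be arrows into
  \<open>K\<close>, because a coproduct over \<open>I\<close> does not constrain
  \<open>\<iota>\<close> outside \<open>I\<close>.\<close>

lemma coproduct_extend:
  assumes cop: "is_coproduct C I X K \<iota>" and sub: "I \<subseteq> J"
    and init: "\<And>j. j \<in> J - I \<Longrightarrow> is_initial C (X j)"
    and inj: "\<And>j. j \<in> J - I \<Longrightarrow> \<iota> j \<in> Hom C (X j) K"
  shows "is_coproduct C J X K \<iota>"
proof (rule coproductI)
  show "K \<in> Ob C"
    using coproduct_Ob[OF cop] .
  show inj': "\<iota> j \<in> Hom C (X j) K" if "j \<in> J" for j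
    using coproduct_inj[OF cop] inj that by blast
  show "u = v" if "u \<in> Hom C K Y" "v \<in> Hom C K Y" "\<And>j. j \<in> J \<Longrightarrow> u \<cdot> \<iota> j = v \<cdot> \<iota> j" for Y u v
    using coproduct_ext[OF cop that(1,2)] that(3) sub by blast
  fix Y f assume Y: "Y \<in> Ob C" and f: "\<And>j. j \<in> J \<Longrightarrow> f j \<in> Hom C (X j) Y"
  obtain u where u: "u \<in> Hom C K Y" "\<And>i. i \<in> I \<Longrightarrow> u \<cdot> \<iota> i = f i"
    using coproduct_factor[OF cop Y, of f] f sub by blast
  have "u \<cdot> \<iota> j = f j" if "j \<in> J" for j
  proof (cases "j \<in> I")
    case False
    then show ?thesis
      using initial_ext[OF init] that inj'[OF that] f[OF that] u(1) Comp_Hom by blast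
  qed (use u(2) in blast)
  then show "\<exists>u \<in> Hom C K Y. \<forall>j \<in> J. u \<cdot> \<iota> j = f j"
    using u(1) by blast
qed

text \<open>The inverse is glued from the inverses of the \<open>\<theta> j\<close>. Since
  \<open>u\<close> is any arrow compatible with the injections, the result also covers arrows
  obtained from a definite description.\<close>

lemma coproduct_map_Iso:
  assumes cop: "is_coproduct C J X K \<iota>" and cop': "is_coproduct C J X' K' \<iota>'"
    and \<theta>: "\<And>j. j \<in> J \<Longrightarrow> \<theta> j \<in> Iso C (X j) (X' j)"
    and u: "u \<in> Hom C K K'" "\<And>j. j \<in> J \<Longrightarrow> u \<cdot> \<iota> j = \<iota>' j \<cdot> \<theta> j"
  shows "u \<in> Iso C K K'"
proof -
  have "\<exists>g. g \<in> Hom C (X' j) (X j) \<and> g \<cdot> \<theta> j = Id C (X j) \<and> \<theta> j \<cdot> g = Id C (X' j)" if "j \<in> J" for j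
    using Iso_inverse[OF \<theta>[OF that]] by metis
  then obtain \<eta> where \<eta>: "\<And>j. j \<in> J \<Longrightarrow> \<eta> j \<in> Hom C (X' j) (X j)"
      "\<And>j. j \<in> J \<Longrightarrow> \<eta> j \<cdot> \<theta> j = Id C (X j)" "\<And>j. j \<in> J \<Longrightarrow> \<theta> j \<cdot> \<eta> j = Id C (X' j)"
    by metis
  note inj = coproduct_inj[OF cop] coproduct_inj[OF cop']
  have K: "K \<in> Ob C" and K': "K' \<in> Ob C"
    using cop cop' coproduct_Ob by auto
  have "\<iota> j \<cdot> \<eta> j \<in> Hom C (X' j) K" if "j \<in> J" for j
    using inj(1) \<eta>(1) that Comp_Hom by blast
  then obtain v where v: "v \<in> Hom C K' K" "\<And>j. j \<in> J \<Longrightarrow> v \<cdot> \<iota>' j = \<iota> j \<cdot> \<eta> j"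
    using coproduct_factor[OF cop' K, of "\<lambda>j. \<iota> j \<cdot> \<eta> j"] by blast
  show ?thesis
  proof (rule IsoI[OF u(1) v(1)])
    show "v \<cdot> u = Id C K"
    proof (rule coproduct_ext[OF cop Comp_Hom[OF u(1) v(1)] Id_Hom[OF K]])
      fix j assume j: "j \<in> J"
      have \<theta>h: "\<theta> j \<in> Hom C (X j) (X' j)"
        using Iso_Hom \<theta> j by blast
      have "(v \<cdot> u) \<cdot> \<iota> j = v \<cdot> (\<iota>' j \<cdot> \<theta> j)"
        using Comp_assoc[OF inj(1)[OF j] u(1) v(1)] u(2) j by simp
      also have "\<dots> = (\<iota> j \<cdot> \<eta> j) \<cdot> \<theta> j"
        using Comp_assoc[OF \<theta>h inj(2)[OF j] v(1)] v(2) j by simp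
      also have "\<dots> = \<iota> j"
        using Comp_assoc[OF \<theta>h \<eta>(1) inj(1)] j \<eta>(2) Comp_Id_right[OF inj(1)] by simp
      finally show "(v \<cdot> u) \<cdot> \<iota> j = Id C K \<cdot> \<iota> j"
        using Comp_Id_left[OF inj(1)] j by simp
    qed
    show "u \<cdot> v = Id C K'"
    proof (rule coproduct_ext[OF cop' Comp_Hom[OF v(1) u(1)] Id_Hom[OF K']])
      fix j assume j: "j \<in> J"
      have \<theta>h: "\<theta> j \<in> Hom C (X j) (X' j)"
        using Iso_Hom \<theta> j by blast
      have "(u \<cdot> v) \<cdot> \<iota>' j = u \<cdot> (\<iota> j \<cdot> \<eta> j)"
        using Comp_assoc[OF inj(2)[OF j] v(1) u(1)] v(2) j by simp
      also have "\<dots> = (\<iota>' j \<cdot> \<theta> j) \<cdot> \<eta> j"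
        using Comp_assoc[OF \<eta>(1)[OF j] inj(1)[OF j] u(1)] u(2) j by simp
      also have "\<dots> = \<iota>' j"
        using Comp_assoc[OF \<eta>(1) \<theta>h inj(2)] j \<eta>(3) Comp_Id_right[OF inj(2)] by simp
      finally show "(u \<cdot> v) \<cdot> \<iota>' j = Id C K' \<cdot> \<iota>' j"
        using Comp_Id_left[OF inj(2)] j by simp
    qed
  qed
qed

text \<open>Gluing the identity of \<open>X j\<close> yields a retraction of
  \<open>\<iota> j\<close>; the composite in the other order is tested on the only
  injection.\<close>

lemma coproduct_singleton_Iso:
  assumes cop: "is_coproduct C {j} X K \<iota>"
  shows "\<iota> j \<in> Iso C (X j) K"
proof -
  have inj: "\<iota> j \<in> Hom C (X j) K"
    using coproduct_inj[OF cop] by simp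
  have Ob: "X j \<in> Ob C" "K \<in> Ob C"
    using Hom_Ob inj by auto
  obtain u where u: "u \<in> Hom C K (X j)" "u \<cdot> \<iota> j = Id C (X j)"
    using coproduct_factor[OF cop Ob(1), of "\<lambda>j. Id C (X j)"] Id_Hom[OF Ob(1)] by auto
  have "\<iota> j \<cdot> u = Id C K"
  proof (rule coproduct_ext[OF cop Comp_Hom[OF u(1) inj] Id_Hom[OF Ob(2)]])
    fix i assume "i \<in> {j}"
    then show "(\<iota> j \<cdot> u) \<cdot> \<iota> i = Id C K \<cdot> \<iota> i"
      using Comp_assoc[OF inj u(1) inj] u(2) Comp_Id_right[OF inj] Comp_Id_left[OF inj] by simp
  qed
  then show ?thesis
    using IsoI inj u by blast
qed

end

section \<open>Rewriting rules for tensor products of arrows\<close>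

context monoidal_category
begin

lemma Tens_typing:
  assumes "f \<in> Ar C" "g \<in> Ar C"
  shows "f \<boxtimes> g \<in> Ar C" "Dom C (f \<boxtimes> g) = Dom C f \<otimes> Dom C g" "Cod C (f \<boxtimes> g) = Cod C f \<otimes> Cod C g"
  using Tens_Hom[of f "Dom C f" "Cod C f" g "Dom C g" "Cod C g"] assms by (auto simp: Hom_iff)

lemma Assoc_typing:
  assumes "X \<in> Ob C" "Y \<in> Ob C" "Z \<in> Ob C"
  shows "Assoc C X Y Z \<in> Ar C" "Dom C (Assoc C X Y Z) = (X \<otimes> Y) \<otimes> Z"
    "Cod C (Assoc C X Y Z) = X \<otimes> (Y \<otimes> Z)"
  using Iso_Hom[OF Assoc_Iso[OF assms]] by (auto simp: Hom_iff)

lemma LUnit_typing: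
  assumes "X \<in> Ob C"
  shows "LUnit C X \<in> Ar C" "Dom C (LUnit C X) = Unit C \<otimes> X" "Cod C (LUnit C X) = X"
  using Iso_Hom[OF LUnit_Iso[OF assms]] by (auto simp: Hom_iff)

lemma RUnit_typing:
  assumes "X \<in> Ob C"
  shows "RUnit C X \<in> Ar C" "Dom C (RUnit C X) = X \<otimes> Unit C" "Cod C (RUnit C X) = X"
  using Iso_Hom[OF RUnit_Iso[OF assms]] by (auto simp: Hom_iff)

lemmas typing = composition Tens_typing Tens_Ob Unit_Ob Assoc_typing LUnit_typing RUnit_typing

lemma interchange:
  assumes "f \<in> Ar C" "f' \<in> Ar C" "g \<in> Ar C" "g' \<in> Ar C" "Cod C f = Dom C f'" "Cod C g = Dom C g'"
  shows "(f' \<boxtimes> g') \<cdot> (f \<boxtimes> g) = (f' \<cdot> f) \<boxtimes> (g' \<cdot> g)"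
  using Tens_Comp[of f "Dom C f" "Dom C f'" f' "Cod C f'" g "Dom C g" "Dom C g'" g' "Cod C g'"] assms
  by (simp add: Hom_iff)

text \<open>In right-nested composites the two tensor products to be merged often stand in front of
  a further arrow \<open>k\<close>, where \<open>interchange\<close> alone finds no match.\<close>

lemma interchange_tail:
  assumes "f \<in> Ar C" "f' \<in> Ar C" "g \<in> Ar C" "g' \<in> Ar C" "Cod C f = Dom C f'" "Cod C g = Dom C g'"
    and "k \<in> Ar C" "Cod C k = Dom C f \<otimes> Dom C g"
  shows "(f' \<boxtimes> g') \<cdot> ((f \<boxtimes> g) \<cdot> k) = ((f' \<cdot> f) \<boxtimes> (g' \<cdot> g)) \<cdot> k"
  using interchange[OF assms(1-6)] Comp_assoc_Ar[of k "f \<boxtimes> g" "f' \<boxtimes> g'"] assms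
  by (simp add: typing)

text \<open>The codomains enter as equations, so that the left-hand side matches all objects
  \<open>X'\<close>, \<open>Y'\<close>, \<open>Z'\<close> that are provably the codomains and not
  only literal terms \<open>Cod C f\<close>.\<close>

lemma Assoc_natural_Ar:
  assumes "f \<in> Ar C" "g \<in> Ar C" "h \<in> Ar C" "X' = Cod C f" "Y' = Cod C g" "Z' = Cod C h"
  shows "Assoc C X' Y' Z' \<cdot> ((f \<boxtimes> g) \<boxtimes> h)
    = (f \<boxtimes> (g \<boxtimes> h)) \<cdot> Assoc C (Dom C f) (Dom C g) (Dom C h)"
  using Assoc_natural[of f "Dom C f" X' g "Dom C g" Y' h "Dom C h" Z'] assms by (simp add: Hom_iff)

end

section \<open>The externally graded category\<close>

locale graded_setting = monoidal_category M
  for M :: "('o, 'm) premonoidal" (structure) +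
  fixes z :: 'o
    and cop :: "('g::monoid_mult, 'o) chosen_cop"
    and inc :: "('g, 'o, 'm) chosen_inc"
  assumes initial_z: "is_initial M z"
    and chosen_coproduct: "(\<forall>p \<in> factorizations g. X p \<in> Ob M) \<Longrightarrow>
          is_coproduct M (factorizations g) X (cop g X) (inc g X)"
    and preserves_initial: "tensor_preserves_initial M"
    and preserves_coproducts: "tensor_preserves_coproducts M (factorizations (g::'g))"
begin

abbreviation gobj :: "('g \<Rightarrow> 'o) \<Rightarrow> bool" where
  "gobj X \<equiv> \<forall>g. X g \<in> Ob M"

abbreviation ghom :: "('g \<Rightarrow> 'o) \<Rightarrow> ('g \<Rightarrow> 'o) \<Rightarrow> ('g \<Rightarrow> 'm) \<Rightarrow> bool" where
  "ghom X Y f \<equiv> \<forall>g. f g \<in> Hom M (X g) (Y g)"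

abbreviation tens :: "('g \<Rightarrow> 'o) \<Rightarrow> ('g \<Rightarrow> 'o) \<Rightarrow> 'g \<Rightarrow> 'o"  (infixr "\<odot>" 75) where
  "X \<odot> Y \<equiv> graded_tens M cop X Y"

abbreviation tens_ar :: "('g \<Rightarrow> 'm) \<Rightarrow> ('g \<Rightarrow> 'm) \<Rightarrow> 'g \<Rightarrow> 'm"  (infixr "\<boxdot>" 75) where
  "f \<boxdot> h \<equiv> graded_tens_ar M cop inc f h"

abbreviation \<iota> :: "('g \<Rightarrow> 'o) \<Rightarrow> ('g \<Rightarrow> 'o) \<Rightarrow> 'g \<Rightarrow> 'g \<Rightarrow> 'm" where
  "\<iota> \<equiv> graded_inj M inc"

abbreviation \<alpha> :: "('g \<Rightarrow> 'o) \<Rightarrow> ('g \<Rightarrow> 'o) \<Rightarrow> ('g \<Rightarrow> 'o) \<Rightarrow> 'g \<Rightarrow> 'm" where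
  "\<alpha> \<equiv> graded_assoc M cop inc"

abbreviation unit :: "'g \<Rightarrow> 'o"  ("\<one>") where
  "\<one> \<equiv> graded_unit M z"

abbreviation lunit :: "('g \<Rightarrow> 'o) \<Rightarrow> 'g \<Rightarrow> 'm" where
  "lunit \<equiv> graded_lunit M z cop inc"

abbreviation runit :: "('g \<Rightarrow> 'o) \<Rightarrow> 'g \<Rightarrow> 'm" where
  "runit \<equiv> graded_runit M z cop inc"

lemma z_Ob: "z \<in> Ob M"
  using initial_z by (simp add: is_initial_def)

lemma initial_tens_z:
  assumes "Y \<in> Ob M"
  shows "is_initial M (Y \<otimes> z)" "is_initial M (z \<otimes> Y)"
  using preserves_initial initial_z assms by (auto simp: tensor_preserves_initial_def)

lemma coproduct_tens_left:
  assumes "is_coproduct M (factorizations (g::'g)) X K k" "Y \<in> Ob M"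
  shows "is_coproduct M (factorizations g) (\<lambda>j. Y \<otimes> X j) (Y \<otimes> K) (\<lambda>j. Id M Y \<boxtimes> k j)"
  using preserves_coproducts[of g] assms unfolding tensor_preserves_coproducts_def by blast

lemma coproduct_tens_right:
  assumes "is_coproduct M (factorizations (g::'g)) X K k" "Y \<in> Ob M"
  shows "is_coproduct M (factorizations g) (\<lambda>j. X j \<otimes> Y) (K \<otimes> Y) (\<lambda>j. k j \<boxtimes> Id M Y)"
  using preserves_coproducts[of g] assms unfolding tensor_preserves_coproducts_def by blast

text \<open>\<open>graded_inj\<close> takes its degree to be \<open>a * b\<close>, while the chosen
  coproduct has the fixed degree \<open>g\<close>. The two agree on \<open>factorizations g\<close>,
  and only the values there matter.\<close>

lemma graded_coproduct:
  assumes "gobj X" "gobj Y"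
  shows "is_coproduct M (factorizations g) (\<lambda>(a, b). X a \<otimes> Y b) ((X \<odot> Y) g) (\<lambda>(a, b). \<iota> X Y a b)"
proof -
  have "\<forall>p \<in> factorizations g. graded_summand M X Y p \<in> Ob M"
    using assms Tens_Ob by (auto simp: graded_summand_def)
  from chosen_coproduct[OF this] show ?thesis
    unfolding graded_tens_def
    by (rule coproduct_cong) (auto simp: graded_summand_def graded_inj_def factorizations_def)
qed

lemma graded_tens_Ob: "\<lbrakk>gobj X; gobj Y\<rbrakk> \<Longrightarrow> (X \<odot> Y) g \<in> Ob M"
  using graded_coproduct coproduct_Ob by blast

lemma graded_inj_typing:
  assumes "gobj X" "gobj Y"
  shows "\<iota> X Y a b \<in> Ar M" "Dom M (\<iota> X Y a b) = X a \<otimes> Y b" "Cod M (\<iota> X Y a b) = (X \<odot> Y) (a * b)"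
  using coproduct_inj[OF graded_coproduct[OF assms, of "a * b"], of "(a, b)"]
  by (auto simp: Hom_iff factorizations_def)

lemma graded_unit_Ob: "\<one> g \<in> Ob M"
  by (simp add: graded_unit_def z_Ob Unit_Ob)

lemma graded_ext:
  assumes "gobj X" "gobj Y" "u \<in> Hom M ((X \<odot> Y) g) W" "v \<in> Hom M ((X \<odot> Y) g) W"
    and "\<And>a b. a * b = g \<Longrightarrow> u \<cdot> \<iota> X Y a b = v \<cdot> \<iota> X Y a b"
  shows "u = v"
  using coproduct_ext[OF graded_coproduct[OF assms(1,2)] assms(3,4)] assms(5)
  by (auto simp: factorizations_def)

section \<open>Threefold and fourfold tensor products as iterated coproducts\<close>

definition linj :: "('g \<Rightarrow> 'o) \<Rightarrow> ('g \<Rightarrow> 'o) \<Rightarrow> ('g \<Rightarrow> 'o) \<Rightarrow> 'g \<Rightarrow> 'g \<Rightarrow> 'g \<Rightarrow> 'm" where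
  "linj X Y Z a b c = \<iota> (X \<odot> Y) Z (a * b) c \<cdot> (\<iota> X Y a b \<boxtimes> Id M (Z c))"

definition rinj :: "('g \<Rightarrow> 'o) \<Rightarrow> ('g \<Rightarrow> 'o) \<Rightarrow> ('g \<Rightarrow> 'o) \<Rightarrow> 'g \<Rightarrow> 'g \<Rightarrow> 'g \<Rightarrow> 'm" where
  "rinj X Y Z a b c = \<iota> X (Y \<odot> Z) a (b * c) \<cdot> (Id M (X a) \<boxtimes> \<iota> Y Z b c)"

lemmas graded_typing = typing graded_tens_Ob graded_inj_typing graded_unit_Ob

lemma linj_typing:
  assumes "gobj X" "gobj Y" "gobj Z"
  shows "linj X Y Z a b c \<in> Ar M" "Dom M (linj X Y Z a b c) = (X a \<otimes> Y b) \<otimes> Z c"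
    "Cod M (linj X Y Z a b c) = ((X \<odot> Y) \<odot> Z) (a * b * c)"
  using assms by (simp_all add: linj_def graded_typing)

lemma rinj_typing:
  assumes "gobj X" "gobj Y" "gobj Z"
  shows "rinj X Y Z a b c \<in> Ar M" "Dom M (rinj X Y Z a b c) = X a \<otimes> (Y b \<otimes> Z c)"
    "Cod M (rinj X Y Z a b c) = (X \<odot> (Y \<odot> Z)) (a * b * c)"
  using assms by (simp_all add: rinj_def graded_typing mult.assoc)

text \<open>For an outer pair \<open>(s, c)\<close>, the coproduct \<open>(X \<odot> Y) s\<close>
  remains one after tensoring with \<open>Z c\<close>, so \<open>coproduct_Sigma\<close> applies.
  Its indices are \<open>((s, c), (a, b))\<close> with \<open>a * b = s\<close>; the redundant
  \<open>s\<close> is removed by a bijection with triples.\<close>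

lemma linj_coproduct:
  assumes "gobj X" "gobj Y" "gobj Z"
  shows "is_coproduct M {(a, b, c). a * b * c = g} (\<lambda>(a, b, c). (X a \<otimes> Y b) \<otimes> Z c)
    (((X \<odot> Y) \<odot> Z) g) (\<lambda>(a, b, c). linj X Y Z a b c)"
proof -
  have XY: "gobj (X \<odot> Y)"
    using assms graded_tens_Ob by blast
  have "is_coproduct M (factorizations (fst p)) (\<lambda>q. (case q of (a, b) \<Rightarrow> X a \<otimes> Y b) \<otimes> Z (snd p))
      ((case p of (s, c) \<Rightarrow> (X \<odot> Y) s \<otimes> Z c)) (\<lambda>q. (case q of (a, b) \<Rightarrow> \<iota> X Y a b) \<boxtimes> Id M (Z (snd p)))" for p
    using coproduct_tens_right[OF graded_coproduct[OF assms(1,2)]] assms(3) by (simp add: split_beta)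
  from coproduct_Sigma[OF graded_coproduct[OF XY assms(3)] this]
  have cop: "is_coproduct M (Sigma (factorizations g) (\<lambda>p. factorizations (fst p)))
      (\<lambda>(p, q). (case q of (a, b) \<Rightarrow> X a \<otimes> Y b) \<otimes> Z (snd p)) (((X \<odot> Y) \<odot> Z) g)
      (\<lambda>(p, q). (case p of (s, c) \<Rightarrow> \<iota> (X \<odot> Y) Z s c) \<cdot> ((case q of (a, b) \<Rightarrow> \<iota> X Y a b) \<boxtimes> Id M (Z (snd p))))" .
  have "bij_betw (\<lambda>(a, b, c). ((a * b, c), (a, b))) {(a, b, c). a * b * c = g}
      (Sigma (factorizations g) (\<lambda>p. factorizations (fst p)))"
    by (rule bij_betw_byWitness[where f' = "\<lambda>((s, c), (a, b)). (a, b, c)"])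
      (auto simp: factorizations_def)
  from coproduct_reindex[OF cop this] show ?thesis
    by (rule coproduct_cong) (auto simp: linj_def)
qed

text \<open>The mirror image, with preservation in the second argument. Associativity of
  \<open>*\<close> gives the same index set as for the other bracketing, as a comparison by
  \<open>coproduct_map_Iso\<close> requires.\<close>

lemma rinj_coproduct:
  assumes "gobj X" "gobj Y" "gobj Z"
  shows "is_coproduct M {(a, b, c). a * b * c = g} (\<lambda>(a, b, c). X a \<otimes> (Y b \<otimes> Z c))
    ((X \<odot> (Y \<odot> Z)) g) (\<lambda>(a, b, c). rinj X Y Z a b c)"
proof -
  have YZ: "gobj (Y \<odot> Z)"
    using assms graded_tens_Ob by blast
  have "is_coproduct M (factorizations (snd p)) (\<lambda>q. X (fst p) \<otimes> (case q of (b, c) \<Rightarrow> Y b \<otimes> Z c))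
      ((case p of (a, t) \<Rightarrow> X a \<otimes> (Y \<odot> Z) t)) (\<lambda>q. Id M (X (fst p)) \<boxtimes> (case q of (b, c) \<Rightarrow> \<iota> Y Z b c))" for p
    using coproduct_tens_left[OF graded_coproduct[OF assms(2,3)]] assms(1) by (simp add: split_beta)
  from coproduct_Sigma[OF graded_coproduct[OF assms(1) YZ] this]
  have cop: "is_coproduct M (Sigma (factorizations g) (\<lambda>p. factorizations (snd p)))
      (\<lambda>(p, q). X (fst p) \<otimes> (case q of (b, c) \<Rightarrow> Y b \<otimes> Z c)) ((X \<odot> (Y \<odot> Z)) g)
      (\<lambda>(p, q). (case p of (a, t) \<Rightarrow> \<iota> X (Y \<odot> Z) a t) \<cdot> (Id M (X (fst p)) \<boxtimes> (case q of (b, c) \<Rightarrow> \<iota> Y Z b c)))" .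
  have "bij_betw (\<lambda>(a, b, c). ((a, b * c), (b, c))) {(a, b, c). a * b * c = g}
      (Sigma (factorizations g) (\<lambda>p. factorizations (snd p)))"
    by (rule bij_betw_byWitness[where f' = "\<lambda>((a, t), (b, c)). (a, b, c)"])
      (auto simp: factorizations_def mult.assoc)
  from coproduct_reindex[OF cop this] show ?thesis
    by (rule coproduct_cong) (auto simp: rinj_def)
qed

lemma linj_ext:
  assumes "gobj X" "gobj Y" "gobj Z"
    and "u \<in> Hom M (((X \<odot> Y) \<odot> Z) g) V" "v \<in> Hom M (((X \<odot> Y) \<odot> Z) g) V"
    and "\<And>a b c. a * b * c = g \<Longrightarrow> u \<cdot> linj X Y Z a b c = v \<cdot> linj X Y Z a b c"
  shows "u = v"
  using coproduct_ext[OF linj_coproduct[OF assms(1-3)] assms(4,5)] assms(6) by auto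

text \<open>The pentagon only requires arrows out of a fourfold product to be separated. Hence it is
  enough to decompose the first factor of each threefold summand once more, by tensoring its
  coproduct twice on the right.\<close>

lemma qinj_ext:
  assumes X: "gobj W" "gobj X" "gobj Y" "gobj Z"
    and u: "u \<in> Hom M ((((W \<odot> X) \<odot> Y) \<odot> Z) g) V" and v: "v \<in> Hom M ((((W \<odot> X) \<odot> Y) \<odot> Z) g) V"
    and eq: "\<And>a b c d. a * b * c * d = g \<Longrightarrow>
      u \<cdot> (linj (W \<odot> X) Y Z (a * b) c d \<cdot> ((\<iota> W X a b \<boxtimes> Id M (Y c)) \<boxtimes> Id M (Z d)))
      = v \<cdot> (linj (W \<odot> X) Y Z (a * b) c d \<cdot> ((\<iota> W X a b \<boxtimes> Id M (Y c)) \<boxtimes> Id M (Z d)))"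
  shows "u = v"
proof (rule linj_ext[OF _ X(3,4) u v])
  show WX: "gobj (W \<odot> X)"
    using X graded_tens_Ob by blast
  fix s c d assume s: "s * c * d = g"
  have cop: "is_coproduct M (factorizations s) (\<lambda>p. ((case p of (a, b) \<Rightarrow> W a \<otimes> X b) \<otimes> Y c) \<otimes> Z d)
      (((W \<odot> X) s \<otimes> Y c) \<otimes> Z d)
      (\<lambda>p. ((case p of (a, b) \<Rightarrow> \<iota> W X a b) \<boxtimes> Id M (Y c)) \<boxtimes> Id M (Z d))"
    using coproduct_tens_right[OF coproduct_tens_right[OF graded_coproduct[OF X(1,2)]]] X(3,4) by blast
  show "u \<cdot> linj (W \<odot> X) Y Z s c d = v \<cdot> linj (W \<odot> X) Y Z s c d"
  proof (rule coproduct_ext[OF cop])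
    show "u \<cdot> linj (W \<odot> X) Y Z s c d \<in> Hom M (((W \<odot> X) s \<otimes> Y c) \<otimes> Z d) V"
      "v \<cdot> linj (W \<odot> X) Y Z s c d \<in> Hom M (((W \<odot> X) s \<otimes> Y c) \<otimes> Z d) V"
      using u v WX X s by (simp_all add: Hom_iff linj_typing composition)
    fix p assume "p \<in> factorizations s"
    then obtain a b where "p = (a, b)" "a * b = s"
      by (auto simp: factorizations_def)
    then show "(u \<cdot> linj (W \<odot> X) Y Z s c d) \<cdot> (((case p of (a, b) \<Rightarrow> \<iota> W X a b) \<boxtimes> Id M (Y c)) \<boxtimes> Id M (Z d))
      = (v \<cdot> linj (W \<odot> X) Y Z s c d) \<cdot> (((case p of (a, b) \<Rightarrow> \<iota> W X a b) \<boxtimes> Id M (Y c)) \<boxtimes> Id M (Z d))"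
      using eq[of a b c d] s u v WX X by (auto simp: Hom_iff linj_typing graded_typing)
  qed
qed

text \<open>Every other factorization of \<open>g\<close> has a left entry different from 1, so its
  summand is \<open>z\<close> tensored with an object and therefore initial.\<close>

lemma unit_coproduct_left:
  assumes "gobj X"
  shows "is_coproduct M {(1, g)} (\<lambda>(a, b). \<one> a \<otimes> X b) ((\<one> \<odot> X) g) (\<lambda>(a, b). \<iota> \<one> X a b)"
proof (rule coproduct_restrict)
  show "is_coproduct M (factorizations g) (\<lambda>(a, b). \<one> a \<otimes> X b) ((\<one> \<odot> X) g) (\<lambda>(a, b). \<iota> \<one> X a b)"
    using graded_coproduct assms graded_unit_Ob by blast
qed (use initial_tens_z assms in \<open>auto simp: factorizations_def graded_unit_def split: if_splits\<close>)

lemma unit_coproduct_right: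
  assumes "gobj X"
  shows "is_coproduct M {(g, 1)} (\<lambda>(a, b). X a \<otimes> \<one> b) ((X \<odot> \<one>) g) (\<lambda>(a, b). \<iota> X \<one> a b)"
proof (rule coproduct_restrict)
  show "is_coproduct M (factorizations g) (\<lambda>(a, b). X a \<otimes> \<one> b) ((X \<odot> \<one>) g) (\<lambda>(a, b). \<iota> X \<one> a b)"
    using graded_coproduct assms graded_unit_Ob by blast
qed (use initial_tens_z assms in \<open>auto simp: factorizations_def graded_unit_def split: if_splits\<close>)

subsection \<open>Structure morphisms\<close>

text \<open>This opens the definite description: \<open>coproduct_factor\<close> provides an arrow
  with the prescribed values on injections, and \<open>graded_ext\<close> shows that there is no
  other. Associator and unitors follow the same pattern.\<close>

lemma graded_tens_ar_spec:
  assumes X: "gobj X" "gobj Y" "gobj X'" "gobj Y'" and f: "ghom X X' f" and h: "ghom Y Y' h"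
  shows "(f \<boxdot> h) g \<in> Hom M ((X \<odot> Y) g) ((X' \<odot> Y') g) \<and>
    (\<forall>a b. a * b = g \<longrightarrow> (f \<boxdot> h) g \<cdot> \<iota> X Y a b = \<iota> X' Y' a b \<cdot> (f a \<boxtimes> h b))"
proof -
  \<comment> \<open>\<open>graded_tens_ar\<close> reads the source and target families off the
    arrows, so they have to be identified with the given families.\<close>
  have eqs: "(\<lambda>a. Dom M (f a)) = X" "(\<lambda>a. Cod M (f a)) = X'"
      "(\<lambda>a. Dom M (h a)) = Y" "(\<lambda>a. Cod M (h a)) = Y'"
    using f h by (auto simp: Hom_iff)
  let ?k = "\<lambda>(a, b). \<iota> X' Y' a b \<cdot> (f a \<boxtimes> h b)"
  have "?k p \<in> Hom M (case p of (a, b) \<Rightarrow> X a \<otimes> Y b) ((X' \<odot> Y') g)" if "p \<in> factorizations g" for p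
    using that X f h by (auto simp: factorizations_def Hom_iff graded_typing)
  then obtain u where u: "u \<in> Hom M ((X \<odot> Y) g) ((X' \<odot> Y') g)"
      "\<And>p. p \<in> factorizations g \<Longrightarrow> u \<cdot> (case p of (a, b) \<Rightarrow> \<iota> X Y a b) = ?k p"
    using coproduct_factor[OF graded_coproduct[OF X(1,2)] graded_tens_Ob[OF X(3,4)], of g ?k] by blast
  let ?P = "\<lambda>u. u \<in> Hom M ((X \<odot> Y) g) ((X' \<odot> Y') g) \<and>
    (\<forall>a b. a * b = g \<longrightarrow> u \<cdot> \<iota> X Y a b = \<iota> X' Y' a b \<cdot> (f a \<boxtimes> h b))"
  have "?P u"
    using u by (force simp: factorizations_def)
  moreover have "v = u" if "?P v" for v
    using that \<open>?P u\<close> by - (rule graded_ext[OF X(1,2)], auto)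
  ultimately have "?P (THE u. ?P u)"
    by (rule theI)
  then show ?thesis
    by (simp add: graded_tens_ar_def eqs)
qed

lemma graded_tens_ar_typing:
  assumes "ghom X X' f" "ghom Y Y' h" "gobj X" "gobj Y" "gobj X'" "gobj Y'"
  shows "(f \<boxdot> h) g \<in> Ar M" "Dom M ((f \<boxdot> h) g) = (X \<odot> Y) g" "Cod M ((f \<boxdot> h) g) = (X' \<odot> Y') g"
  using graded_tens_ar_spec[OF assms(3-6,1,2)] by (simp_all add: Hom_iff)

lemma graded_tens_ar_inj:
  assumes "ghom X X' f" "ghom Y Y' h" "gobj X" "gobj Y" "gobj X'" "gobj Y'" "a * b = g"
  shows "(f \<boxdot> h) g \<cdot> \<iota> X Y a b = \<iota> X' Y' a b \<cdot> (f a \<boxtimes> h b)"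
  using graded_tens_ar_spec[OF assms(3-6,1,2)] assms(7) by simp

lemma graded_assoc_spec:
  assumes X: "gobj X" "gobj Y" "gobj Z"
  shows "\<alpha> X Y Z g \<in> Hom M (((X \<odot> Y) \<odot> Z) g) ((X \<odot> (Y \<odot> Z)) g) \<and>
    (\<forall>a b c. a * b * c = g \<longrightarrow>
      \<alpha> X Y Z g \<cdot> linj X Y Z a b c = rinj X Y Z a b c \<cdot> Assoc M (X a) (Y b) (Z c))"
proof -
  have Ob: "(X \<odot> (Y \<odot> Z)) g \<in> Ob M"
    using X graded_tens_Ob by blast
  let ?T = "{(a, b, c). a * b * c = g}"
  let ?k = "\<lambda>(a, b, c). rinj X Y Z a b c \<cdot> Assoc M (X a) (Y b) (Z c)"
  have "?k p \<in> Hom M (case p of (a, b, c) \<Rightarrow> (X a \<otimes> Y b) \<otimes> Z c) ((X \<odot> (Y \<odot> Z)) g)" if "p \<in> ?T" for p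
    using that X by (auto simp: Hom_iff graded_typing rinj_typing)
  then obtain u where u: "u \<in> Hom M (((X \<odot> Y) \<odot> Z) g) ((X \<odot> (Y \<odot> Z)) g)"
      "\<And>p. p \<in> ?T \<Longrightarrow> u \<cdot> (case p of (a, b, c) \<Rightarrow> linj X Y Z a b c) = ?k p"
    using coproduct_factor[OF linj_coproduct[OF X] Ob, of g ?k] by blast
  let ?P = "\<lambda>u. u \<in> Hom M (((X \<odot> Y) \<odot> Z) g) ((X \<odot> (Y \<odot> Z)) g) \<and>
    (\<forall>a b c. a * b * c = g \<longrightarrow> u \<cdot> linj X Y Z a b c = rinj X Y Z a b c \<cdot> Assoc M (X a) (Y b) (Z c))"
  have "?P u"
    using u by force
  moreover have "v = u" if "?P v" for v
    using that \<open>?P u\<close> by - (rule linj_ext[OF X], auto)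
  ultimately have P: "?P (THE u. ?P u)"
    by (rule theI)
  \<comment> \<open>The definition of the associator nests this composite to the right, whereas
    \<open>rinj\<close> groups the two injections.\<close>
  have "rinj X Y Z a b c \<cdot> Assoc M (X a) (Y b) (Z c) = \<iota> X (Y \<odot> Z) a (b * c) \<cdot>
      ((Id M (X a) \<boxtimes> \<iota> Y Z b c) \<cdot> Assoc M (X a) (Y b) (Z c))" for a b c
    using X by (simp add: rinj_def graded_typing)
  then have "\<alpha> X Y Z g = (THE u. ?P u)"
    by (simp add: graded_assoc_def linj_def Let_def)
  then show ?thesis
    using P by simp
qed

lemma graded_assoc_typing:
  assumes "gobj X" "gobj Y" "gobj Z"
  shows "\<alpha> X Y Z g \<in> Ar M" "Dom M (\<alpha> X Y Z g) = ((X \<odot> Y) \<odot> Z) g"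
    "Cod M (\<alpha> X Y Z g) = (X \<odot> (Y \<odot> Z)) g"
  using graded_assoc_spec[OF assms] by (simp_all add: Hom_iff)

lemma graded_assoc_inj:
  assumes "gobj X" "gobj Y" "gobj Z" "a * b * c = g"
  shows "\<alpha> X Y Z g \<cdot> linj X Y Z a b c = rinj X Y Z a b c \<cdot> Assoc M (X a) (Y b) (Z c)"
  using graded_assoc_spec[OF assms(1-3)] assms(4) by simp

text \<open>The associators of \<open>M\<close> carry one threefold cocone to the other summand by
  summand, and each of them is invertible.\<close>

lemma graded_assoc_Iso:
  assumes X: "gobj X" "gobj Y" "gobj Z"
  shows "\<alpha> X Y Z g \<in> Iso M (((X \<odot> Y) \<odot> Z) g) ((X \<odot> (Y \<odot> Z)) g)"
  by (rule coproduct_map_Iso[OF linj_coproduct[OF X] rinj_coproduct[OF X],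
        where \<theta> = "\<lambda>(a, b, c). Assoc M (X a) (Y b) (Z c)"])
    (use X graded_assoc_spec[OF X] Assoc_Iso in auto)

text \<open>As \<open>(1, g)\<close> is the only summand that counts, its injection is invertible;
  an arrow whose composite with it is the isomorphism \<open>LUnit M (X g)\<close> is then
  invertible too.\<close>

lemma graded_lunit_spec:
  assumes X: "gobj X"
  shows "lunit X g \<in> Iso M ((\<one> \<odot> X) g) (X g) \<and> lunit X g \<cdot> \<iota> \<one> X 1 g = LUnit M (X g)"
proof -
  note cop = unit_coproduct_left[OF X, of g]
  have iso: "\<iota> \<one> X 1 g \<in> Iso M (Unit M \<otimes> X g) ((\<one> \<odot> X) g)"
    using coproduct_singleton_Iso[OF cop] by (simp add: graded_unit_def)
  have L: "LUnit M (X g) \<in> Iso M (Unit M \<otimes> X g) (X g)"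
    using LUnit_Iso X by blast
  obtain u where u: "u \<in> Hom M ((\<one> \<odot> X) g) (X g)" "u \<cdot> \<iota> \<one> X 1 g = LUnit M (X g)"
    using coproduct_factor[OF cop, of "X g" "\<lambda>_. LUnit M (X g)"] X Iso_Hom[OF L]
    by (auto simp: graded_unit_def)
  let ?P = "\<lambda>u. u \<in> Hom M ((\<one> \<odot> X) g) (X g) \<and> u \<cdot> \<iota> \<one> X 1 g = LUnit M (X g)"
  have "v = u" if "?P v" for v
    using that u by - (rule coproduct_ext[OF cop], auto)
  with u have "?P (THE u. ?P u)"
    by (intro theI[of ?P]) auto
  then have "?P (lunit X g)"
    by (simp add: graded_lunit_def)
  then show ?thesis
    using Iso_cancel_left[OF iso L] by blast
qed

lemma graded_runit_spec:
  assumes X: "gobj X"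
  shows "runit X g \<in> Iso M ((X \<odot> \<one>) g) (X g) \<and> runit X g \<cdot> \<iota> X \<one> g 1 = RUnit M (X g)"
proof -
  note cop = unit_coproduct_right[OF X, of g]
  have iso: "\<iota> X \<one> g 1 \<in> Iso M (X g \<otimes> Unit M) ((X \<odot> \<one>) g)"
    using coproduct_singleton_Iso[OF cop] by (simp add: graded_unit_def)
  have L: "RUnit M (X g) \<in> Iso M (X g \<otimes> Unit M) (X g)"
    using RUnit_Iso X by blast
  obtain u where u: "u \<in> Hom M ((X \<odot> \<one>) g) (X g)" "u \<cdot> \<iota> X \<one> g 1 = RUnit M (X g)"
    using coproduct_factor[OF cop, of "X g" "\<lambda>_. RUnit M (X g)"] X Iso_Hom[OF L]
    by (auto simp: graded_unit_def)
  let ?P = "\<lambda>u. u \<in> Hom M ((X \<odot> \<one>) g) (X g) \<and> u \<cdot> \<iota> X \<one> g 1 = RUnit M (X g)"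
  have "v = u" if "?P v" for v
    using that u by - (rule coproduct_ext[OF cop], auto)
  with u have "?P (THE u. ?P u)"
    by (intro theI[of ?P]) auto
  then have "?P (runit X g)"
    by (simp add: graded_runit_def)
  then show ?thesis
    using Iso_cancel_left[OF iso L] by blast
qed

lemma graded_unitor_typing:
  assumes "gobj X"
  shows "lunit X g \<in> Ar M" "Dom M (lunit X g) = (\<one> \<odot> X) g" "Cod M (lunit X g) = X g"
    "runit X g \<in> Ar M" "Dom M (runit X g) = (X \<odot> \<one>) g" "Cod M (runit X g) = X g"
  using Iso_Hom[OF conjunct1[OF graded_lunit_spec[OF assms, of g]]]
    Iso_Hom[OF conjunct1[OF graded_runit_spec[OF assms, of g]]] by (auto simp: Hom_iff)

lemmas graded_arrow_typing =
  graded_typing linj_typing rinj_typing graded_assoc_typing graded_unitor_typing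

lemma ghom_Id: "gobj X \<Longrightarrow> ghom X X (\<lambda>g. Id M (X g))"
  using Id_Hom by blast

lemma ghom_tens:
  "\<lbrakk>ghom X X' f; ghom Y Y' h; gobj X; gobj Y; gobj X'; gobj Y'\<rbrakk> \<Longrightarrow> ghom (X \<odot> Y) (X' \<odot> Y') (f \<boxdot> h)"
  using graded_tens_ar_spec by blast

lemma gobj_tens: "\<lbrakk>gobj X; gobj Y\<rbrakk> \<Longrightarrow> gobj (X \<odot> Y)"
  using graded_tens_Ob by blast

lemma ghom_assoc: "\<lbrakk>gobj X; gobj Y; gobj Z\<rbrakk> \<Longrightarrow> ghom ((X \<odot> Y) \<odot> Z) (X \<odot> (Y \<odot> Z)) (\<alpha> X Y Z)"
  using graded_assoc_spec by blast

lemma ghom_lunit: "gobj X \<Longrightarrow> ghom (\<one> \<odot> X) X (lunit X)"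
  using graded_lunit_spec Iso_Hom by blast

lemma ghom_runit: "gobj X \<Longrightarrow> ghom (X \<odot> \<one>) X (runit X)"
  using graded_runit_spec Iso_Hom by blast

lemma ghom_typing:
  assumes "ghom X Y f"
  shows "f g \<in> Ar M" "Dom M (f g) = X g" "Cod M (f g) = Y g"
  using assms by (simp_all add: Hom_iff)

section \<open>Functoriality, naturality and coherence\<close>

lemma graded_tens_Id:
  assumes X: "gobj X" "gobj Y"
  shows "((\<lambda>g. Id M (X g)) \<boxdot> (\<lambda>g. Id M (Y g))) g = Id M ((X \<odot> Y) g)"
proof (rule graded_ext[OF X])
  note t = graded_tens_ar_inj[OF ghom_Id ghom_Id] graded_tens_ar_typing[OF ghom_Id ghom_Id]
  show "((\<lambda>g. Id M (X g)) \<boxdot> (\<lambda>g. Id M (Y g))) g \<in> Hom M ((X \<odot> Y) g) ((X \<odot> Y) g)"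
    using X by (simp add: Hom_iff t)
  show "Id M ((X \<odot> Y) g) \<in> Hom M ((X \<odot> Y) g) ((X \<odot> Y) g)"
    using X Id_Hom graded_tens_Ob by blast
  fix a b assume "a * b = g"
  then show "((\<lambda>g. Id M (X g)) \<boxdot> (\<lambda>g. Id M (Y g))) g \<cdot> \<iota> X Y a b = Id M ((X \<odot> Y) g) \<cdot> \<iota> X Y a b"
    using X by (auto simp: t Tens_Id graded_typing)
qed

lemma graded_tens_Comp:
  assumes X: "gobj X" "gobj X'" "gobj X''" "gobj Y" "gobj Y'" "gobj Y''"
    and f: "ghom X X' f" "ghom X' X'' f'" and h: "ghom Y Y' h" "ghom Y' Y'' h'"
  shows "((\<lambda>g. f' g \<cdot> f g) \<boxdot> (\<lambda>g. h' g \<cdot> h g)) g = (f' \<boxdot> h') g \<cdot> (f \<boxdot> h) g"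
proof (rule graded_ext[OF X(1,4)])
  have c: "ghom X X'' (\<lambda>g. f' g \<cdot> f g)" "ghom Y Y'' (\<lambda>g. h' g \<cdot> h g)"
    using f h Comp_Hom by blast+
  note inj = graded_tens_ar_inj[OF f(1) h(1)] graded_tens_ar_inj[OF f(2) h(2)] graded_tens_ar_inj[OF c]
  note ty = graded_tens_ar_typing[OF f(1) h(1)] graded_tens_ar_typing[OF f(2) h(2)]
    graded_tens_ar_typing[OF c] ghom_typing[OF f(1)] ghom_typing[OF f(2)]
    ghom_typing[OF h(1)] ghom_typing[OF h(2)] graded_typing
  show "((\<lambda>g. f' g \<cdot> f g) \<boxdot> (\<lambda>g. h' g \<cdot> h g)) g \<in> Hom M ((X \<odot> Y) g) ((X'' \<odot> Y'') g)"
    "(f' \<boxdot> h') g \<cdot> (f \<boxdot> h) g \<in> Hom M ((X \<odot> Y) g) ((X'' \<odot> Y'') g)"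
    using X by (simp_all add: Hom_iff ty)
  fix a b assume g: "a * b = g"
  show "((\<lambda>g. f' g \<cdot> f g) \<boxdot> (\<lambda>g. h' g \<cdot> h g)) g \<cdot> \<iota> X Y a b = ((f' \<boxdot> h') g \<cdot> (f \<boxdot> h) g) \<cdot> \<iota> X Y a b"
    \<comment> \<open>Once \<open>(f \<boxdot> h) g\<close> has passed the injection,
      \<open>(f' \<boxdot> h') g\<close> meets an injection with \<open>f a \<boxtimes> h b\<close>
      still behind it; hence the tail form of its rule.\<close>
    using X g by (simp add: ty inj inj(2)[THEN Comp_eq_tail] interchange)
qed

text \<open>Passing a triple injection in one go leaves an equation in \<open>M\<close> between
  arrows on \<open>X a\<close>, \<open>Y b\<close>, \<open>Z c\<close>, which is where naturality of
  the associator is available.\<close>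

lemma graded_tens_ar_linj:
  assumes f: "ghom X X' f" and h: "ghom Y Y' h" and k: "ghom Z Z' k"
    and X: "gobj X" "gobj Y" "gobj Z" "gobj X'" "gobj Y'" "gobj Z'" and g: "a * b * c = g"
  shows "((f \<boxdot> h) \<boxdot> k) g \<cdot> linj X Y Z a b c = linj X' Y' Z' a b c \<cdot> ((f a \<boxtimes> h b) \<boxtimes> k c)"
proof -
  have fh: "ghom (X \<odot> Y) (X' \<odot> Y') (f \<boxdot> h)"
    using ghom_tens f h X by blast
  note inj = graded_tens_ar_inj[OF f h] graded_tens_ar_inj[OF fh k]
  note ty = graded_tens_ar_typing[OF f h] graded_tens_ar_typing[OF fh k]
    ghom_typing[OF f] ghom_typing[OF h] ghom_typing[OF k] graded_typing
  show ?thesis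
    using X g by (simp add: linj_def ty inj inj(2)[THEN Comp_eq_tail] interchange)
qed

lemma graded_tens_ar_rinj:
  assumes f: "ghom X X' f" and h: "ghom Y Y' h" and k: "ghom Z Z' k"
    and X: "gobj X" "gobj Y" "gobj Z" "gobj X'" "gobj Y'" "gobj Z'" and g: "a * b * c = g"
  shows "(f \<boxdot> (h \<boxdot> k)) g \<cdot> rinj X Y Z a b c = rinj X' Y' Z' a b c \<cdot> (f a \<boxtimes> (h b \<boxtimes> k c))"
proof -
  have hk: "ghom (Y \<odot> Z) (Y' \<odot> Z') (h \<boxdot> k)"
    using ghom_tens h k X by blast
  note inj = graded_tens_ar_inj[OF h k] graded_tens_ar_inj[OF f hk]
  note ty = graded_tens_ar_typing[OF h k] graded_tens_ar_typing[OF f hk]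
    ghom_typing[OF f] ghom_typing[OF h] ghom_typing[OF k] graded_typing
  show ?thesis
    using X g by (simp add: rinj_def ty inj inj(2)[THEN Comp_eq_tail] interchange mult.assoc)
qed

lemma graded_assoc_natural:
  assumes f: "ghom X X' f" and h: "ghom Y Y' h" and k: "ghom Z Z' k"
    and X: "gobj X" "gobj Y" "gobj Z" "gobj X'" "gobj Y'" "gobj Z'"
  shows "\<alpha> X' Y' Z' g \<cdot> ((f \<boxdot> h) \<boxdot> k) g = (f \<boxdot> (h \<boxdot> k)) g \<cdot> \<alpha> X Y Z g"
proof (rule linj_ext[OF X(1-3)])
  have t: "ghom (X \<odot> Y) (X' \<odot> Y') (f \<boxdot> h)" "ghom (Y \<odot> Z) (Y' \<odot> Z') (h \<boxdot> k)"
    using ghom_tens f h k X by blast+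
  note ty = graded_tens_ar_typing[OF f t(2)] graded_tens_ar_typing[OF t(1) k]
    ghom_typing[OF f] ghom_typing[OF h] ghom_typing[OF k] graded_arrow_typing
  show "\<alpha> X' Y' Z' g \<cdot> ((f \<boxdot> h) \<boxdot> k) g \<in> Hom M (((X \<odot> Y) \<odot> Z) g) ((X' \<odot> (Y' \<odot> Z')) g)"
    "(f \<boxdot> (h \<boxdot> k)) g \<cdot> \<alpha> X Y Z g \<in> Hom M (((X \<odot> Y) \<odot> Z) g) ((X' \<odot> (Y' \<odot> Z')) g)"
    using X by (simp_all add: Hom_iff ty)
  fix a b c assume g: "a * b * c = g"
  note l = graded_tens_ar_linj[OF f h k X g] and r = graded_tens_ar_rinj[OF f h k X g]
    and A = graded_assoc_inj[OF X(1-3) g] and A' = graded_assoc_inj[OF X(4-6) g]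
  show "(\<alpha> X' Y' Z' g \<cdot> ((f \<boxdot> h) \<boxdot> k) g) \<cdot> linj X Y Z a b c
      = ((f \<boxdot> (h \<boxdot> k)) g \<cdot> \<alpha> X Y Z g) \<cdot> linj X Y Z a b c"
    using X g
    by (simp add: ty l A A'[THEN Comp_eq_tail] r[THEN Comp_eq_tail] Assoc_natural_Ar)
qed

text \<open>The injection at \<open>(1, g)\<close> alone separates arrows out of
  \<open>(\<one> \<odot> X) g\<close>, so a single instance of naturality in \<open>M\<close>
  decides.\<close>

lemma graded_lunit_natural:
  assumes f: "ghom X X' f" and X: "gobj X" "gobj X'"
  shows "lunit X' g \<cdot> ((\<lambda>g. Id M (\<one> g)) \<boxdot> f) g = f g \<cdot> lunit X g"
proof (rule coproduct_ext[OF unit_coproduct_left[OF X(1)]])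
  have U: "gobj \<one>"
    using graded_unit_Ob by blast
  have U1: "\<one> 1 = Unit M"
    by (simp add: graded_unit_def)
  note ty = graded_tens_ar_typing[OF ghom_Id[OF U] f] ghom_typing[OF f] graded_arrow_typing
  show "lunit X' g \<cdot> ((\<lambda>g. Id M (\<one> g)) \<boxdot> f) g \<in> Hom M ((\<one> \<odot> X) g) (X' g)"
    "f g \<cdot> lunit X g \<in> Hom M ((\<one> \<odot> X) g) (X' g)"
    using X U by (simp_all add: Hom_iff ty)
  fix p :: "'g \<times> 'g" assume p: "p \<in> {(1, g)}"
  note inj = graded_tens_ar_inj[OF ghom_Id[OF U] f]
    and L = conjunct2[OF graded_lunit_spec[OF X(1)]] and L' = conjunct2[OF graded_lunit_spec[OF X(2)]]
  have "LUnit M (X' g) \<cdot> (Id M (Unit M) \<boxtimes> f g) = f g \<cdot> LUnit M (X g)"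
    using LUnit_natural f by blast
  then show "(lunit X' g \<cdot> ((\<lambda>g. Id M (\<one> g)) \<boxdot> f) g) \<cdot> (case p of (a, b) \<Rightarrow> \<iota> \<one> X a b)
      = (f g \<cdot> lunit X g) \<cdot> (case p of (a, b) \<Rightarrow> \<iota> \<one> X a b)"
    using X U p by (simp add: ty inj L L'[THEN Comp_eq_tail] U1)
qed

lemma graded_runit_natural:
  assumes f: "ghom X X' f" and X: "gobj X" "gobj X'"
  shows "runit X' g \<cdot> (f \<boxdot> (\<lambda>g. Id M (\<one> g))) g = f g \<cdot> runit X g"
proof (rule coproduct_ext[OF unit_coproduct_right[OF X(1)]])
  have U: "gobj \<one>"
    using graded_unit_Ob by blast
  have U1: "\<one> 1 = Unit M"
    by (simp add: graded_unit_def)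
  note ty = graded_tens_ar_typing[OF f ghom_Id[OF U]] ghom_typing[OF f] graded_arrow_typing
  show "runit X' g \<cdot> (f \<boxdot> (\<lambda>g. Id M (\<one> g))) g \<in> Hom M ((X \<odot> \<one>) g) (X' g)"
    "f g \<cdot> runit X g \<in> Hom M ((X \<odot> \<one>) g) (X' g)"
    using X U by (simp_all add: Hom_iff ty)
  fix p :: "'g \<times> 'g" assume p: "p \<in> {(g, 1)}"
  note inj = graded_tens_ar_inj[OF f ghom_Id[OF U]]
    and L = conjunct2[OF graded_runit_spec[OF X(1)]] and L' = conjunct2[OF graded_runit_spec[OF X(2)]]
  have "RUnit M (X' g) \<cdot> (f g \<boxtimes> Id M (Unit M)) = f g \<cdot> RUnit M (X g)"
    using RUnit_natural f by blast
  then show "(runit X' g \<cdot> (f \<boxdot> (\<lambda>g. Id M (\<one> g))) g) \<cdot> (case p of (a, b) \<Rightarrow> \<iota> X \<one> a b)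
      = (f g \<cdot> runit X g) \<cdot> (case p of (a, b) \<Rightarrow> \<iota> X \<one> a b)"
    using X U p by (simp add: ty inj L L'[THEN Comp_eq_tail] U1)
qed

lemma graded_triangle:
  assumes X: "gobj X" "gobj Y"
  shows "((\<lambda>g. Id M (X g)) \<boxdot> lunit Y) g \<cdot> \<alpha> X \<one> Y g = (runit X \<boxdot> (\<lambda>g. Id M (Y g))) g"
proof -
  have U: "gobj \<one>" and XU: "gobj (X \<odot> \<one>)" and UY: "gobj (\<one> \<odot> Y)"
    using graded_unit_Ob X gobj_tens by blast+
  have i: "ghom X X (\<lambda>g. Id M (X g))" "ghom Y Y (\<lambda>g. Id M (Y g))"
    using ghom_Id X by blast+
  note r = ghom_runit[OF X(1)] and l = ghom_lunit[OF X(2)]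
  note ty = graded_tens_ar_typing[OF i(1) l] graded_tens_ar_typing[OF r i(2)] graded_arrow_typing
  note inj = graded_tens_ar_inj[OF i(1) l] graded_tens_ar_inj[OF r i(2)]
  let ?u = "((\<lambda>g. Id M (X g)) \<boxdot> lunit Y) g \<cdot> \<alpha> X \<one> Y g" and ?v = "(runit X \<boxdot> (\<lambda>g. Id M (Y g))) g"
  have u: "?u \<in> Hom M (((X \<odot> \<one>) \<odot> Y) g) ((X \<odot> Y) g)" and v: "?v \<in> Hom M (((X \<odot> \<one>) \<odot> Y) g) ((X \<odot> Y) g)"
    using X U XU UY by (simp_all add: Hom_iff ty)
  show ?thesis
  proof (rule linj_ext[OF X(1) U X(2) u v])
    fix a c b assume g: "a * c * b = g"
    show "?u \<cdot> linj X \<one> Y a c b = ?v \<cdot> linj X \<one> Y a c b"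
    proof (cases "c = 1")
      case False
      \<comment> \<open>In a middle degree other than 1 the summand is initial, so the two
        composites agree without any computation; only middle degree 1 involves the triangle of
        \<open>M\<close>.\<close>
      have "is_initial M ((X a \<otimes> z) \<otimes> Y b)"
        using preserves_initial initial_tens_z X by (auto simp: tensor_preserves_initial_def)
      moreover have "linj X \<one> Y a c b \<in> Hom M ((X a \<otimes> z) \<otimes> Y b) (((X \<odot> \<one>) \<odot> Y) g)"
        using X U g False by (simp add: Hom_iff ty) (simp add: graded_unit_def)
      ultimately show ?thesis
        using initial_ext u v Comp_Hom by blast
    next
      case True
      have L: "lunit Y b \<cdot> \<iota> \<one> Y 1 b = LUnit M (Y b)" and R: "runit X a \<cdot> \<iota> X \<one> a 1 = RUnit M (X a)"
        using graded_lunit_spec graded_runit_spec X by blast+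
      have U1: "\<one> 1 = Unit M"
        by (simp add: graded_unit_def)
      have A: "\<alpha> X \<one> Y g \<cdot> linj X \<one> Y a 1 b = rinj X \<one> Y a 1 b \<cdot> Assoc M (X a) (Unit M) (Y b)"
        using graded_assoc_inj[OF X(1) U X(2), of a 1 b g] g True U1 by simp
      have "?u \<cdot> linj X \<one> Y a 1 b
          = ((\<lambda>g. Id M (X g)) \<boxdot> lunit Y) g \<cdot> (rinj X \<one> Y a 1 b \<cdot> Assoc M (X a) (Unit M) (Y b))"
        using X U XU UY g True A by (simp add: ty)
      also have "\<dots> = \<iota> X Y a b \<cdot> ((Id M (X a) \<boxtimes> LUnit M (Y b)) \<cdot> Assoc M (X a) (Unit M) (Y b))"
        using X U XU UY g True U1
        by (simp add: ty rinj_def inj[THEN Comp_eq_tail] interchange_tail L)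
      also have "\<dots> = \<iota> X Y a b \<cdot> (RUnit M (X a) \<boxtimes> Id M (Y b))"
        using X triangle by simp
      also have "\<dots> = ?v \<cdot> linj X \<one> Y a 1 b"
        using X U XU UY g True U1
        by (simp add: ty linj_def inj[THEN Comp_eq_tail] interchange R)
      finally show ?thesis
        using True by simp
    qed
  qed
qed

text \<open>On the summand with indices \<open>a\<close>, \<open>b\<close>, \<open>c\<close>,
  \<open>d\<close>, both sides become the injection \<open>?r\<close> of
  \<open>W a \<otimes> (X b \<otimes> (Y c \<otimes> Z d))\<close> composed with the two sides of
  the pentagon in \<open>M\<close>. Moving an associator past an injection changes the bracketing of
  that injection, so it has to be regrouped before the next associator can move.\<close>

lemma graded_pentagon:
  assumes X: "gobj W" "gobj X" "gobj Y" "gobj Z"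
  shows "((\<lambda>g. Id M (W g)) \<boxdot> \<alpha> X Y Z) g \<cdot> (\<alpha> W (X \<odot> Y) Z g \<cdot> (\<alpha> W X Y \<boxdot> (\<lambda>g. Id M (Z g))) g)
    = \<alpha> W X (Y \<odot> Z) g \<cdot> \<alpha> (W \<odot> X) Y Z g"
proof (rule qinj_ext[OF X])
  have T: "gobj (W \<odot> X)" "gobj (X \<odot> Y)" "gobj (Y \<odot> Z)" "gobj ((W \<odot> X) \<odot> Y)" "gobj (W \<odot> (X \<odot> Y))"
      "gobj ((X \<odot> Y) \<odot> Z)" "gobj (X \<odot> (Y \<odot> Z))"
    using X by (simp_all add: graded_tens_Ob)
  have i: "ghom W W (\<lambda>g. Id M (W g))" "ghom Z Z (\<lambda>g. Id M (Z g))"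
    using ghom_Id X by blast+
  note a1 = ghom_assoc[OF X(1-3)] and a2 = ghom_assoc[OF X(2-4)]
  note ty = graded_tens_ar_typing[OF i(1) a2] graded_tens_ar_typing[OF a1 i(2)] graded_arrow_typing
  note inj1 = graded_tens_ar_inj[OF i(1) a2] and inj2 = graded_tens_ar_inj[OF a1 i(2)]
  let ?f = "((\<lambda>g. Id M (W g)) \<boxdot> \<alpha> X Y Z) g" and ?h = "(\<alpha> W X Y \<boxdot> (\<lambda>g. Id M (Z g))) g"
  show "?f \<cdot> (\<alpha> W (X \<odot> Y) Z g \<cdot> ?h) \<in> Hom M ((((W \<odot> X) \<odot> Y) \<odot> Z) g) ((W \<odot> (X \<odot> (Y \<odot> Z))) g)"
    "\<alpha> W X (Y \<odot> Z) g \<cdot> \<alpha> (W \<odot> X) Y Z g \<in> Hom M ((((W \<odot> X) \<odot> Y) \<odot> Z) g) ((W \<odot> (X \<odot> (Y \<odot> Z))) g)"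
    using X T by (simp_all add: Hom_iff ty)
  fix a b c d assume g: "a * b * c * d = g"
  let ?q = "linj (W \<odot> X) Y Z (a * b) c d \<cdot> ((\<iota> W X a b \<boxtimes> Id M (Y c)) \<boxtimes> Id M (Z d))"
  let ?A = "Assoc M"
  let ?r = "\<iota> W (X \<odot> (Y \<odot> Z)) a (b * c * d) \<cdot> (Id M (W a) \<boxtimes> rinj X Y Z b c d)"
  \<comment> \<open>One equation for each associator of the pentagon. Those in \<open>A1\<close> and
    \<open>A3\<close> occur inside a tensor product with an identity, hence in degrees
    \<open>a * b * c\<close> and \<open>b * c * d\<close> instead of \<open>g\<close>.\<close>
  have A1: "\<alpha> W X Y (a * b * c) \<cdot> linj W X Y a b c = rinj W X Y a b c \<cdot> ?A (W a) (X b) (Y c)"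
    and A2: "\<alpha> W (X \<odot> Y) Z g \<cdot> linj W (X \<odot> Y) Z a (b * c) d
      = rinj W (X \<odot> Y) Z a (b * c) d \<cdot> ?A (W a) ((X \<odot> Y) (b * c)) (Z d)"
    and A3: "\<alpha> X Y Z (b * c * d) \<cdot> linj X Y Z b c d = rinj X Y Z b c d \<cdot> ?A (X b) (Y c) (Z d)"
    and A4: "\<alpha> (W \<odot> X) Y Z g \<cdot> linj (W \<odot> X) Y Z (a * b) c d
      = rinj (W \<odot> X) Y Z (a * b) c d \<cdot> ?A ((W \<odot> X) (a * b)) (Y c) (Z d)"
    and A5: "\<alpha> W X (Y \<odot> Z) g \<cdot> linj W X (Y \<odot> Z) a b (c * d)
      = rinj W X (Y \<odot> Z) a b (c * d) \<cdot> ?A (W a) (X b) ((Y \<odot> Z) (c * d))"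
    using X T g by (auto intro!: graded_assoc_inj simp: mult.assoc)
  \<comment> \<open>The injection \<open>?q\<close> is regrouped so that its first three indices
    form a \<open>linj\<close>, to which \<open>A1\<close> applies under the tensor product with
    \<open>Z d\<close>.\<close>
  have "?h \<cdot> ?q = ?h \<cdot> (\<iota> ((W \<odot> X) \<odot> Y) Z (a * b * c) d \<cdot> (linj W X Y a b c \<boxtimes> Id M (Z d)))"
    using X T by (simp add: linj_def ty interchange)
  also have "\<dots> = \<iota> (W \<odot> (X \<odot> Y)) Z (a * b * c) d \<cdot>
      ((rinj W X Y a b c \<cdot> ?A (W a) (X b) (Y c)) \<boxtimes> Id M (Z d))"
    using X T g by (simp add: ty inj2 inj2[THEN Comp_eq_tail] interchange A1)
  also have "\<dots> = linj W (X \<odot> Y) Z a (b * c) d \<cdot>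
      (((Id M (W a) \<boxtimes> \<iota> X Y b c) \<boxtimes> Id M (Z d)) \<cdot> (?A (W a) (X b) (Y c) \<boxtimes> Id M (Z d)))"
    using X T by (simp add: linj_def rinj_def ty interchange mult.assoc)
  finally have hq: "?h \<cdot> ?q = \<dots>" .
  have "\<alpha> W (X \<odot> Y) Z g \<cdot> (?h \<cdot> ?q) = rinj W (X \<odot> Y) Z a (b * c) d \<cdot>
      ((Id M (W a) \<boxtimes> (\<iota> X Y b c \<boxtimes> Id M (Z d))) \<cdot>
       (?A (W a) (X b \<otimes> Y c) (Z d) \<cdot> (?A (W a) (X b) (Y c) \<boxtimes> Id M (Z d))))"
    unfolding hq using X T g
    by (simp add: ty A2[THEN Comp_eq_tail] Assoc_natural_Ar[THEN Comp_eq_tail] mult.assoc)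
  also have "\<dots> = \<iota> W ((X \<odot> Y) \<odot> Z) a (b * c * d) \<cdot> ((Id M (W a) \<boxtimes> linj X Y Z b c d) \<cdot>
       (?A (W a) (X b \<otimes> Y c) (Z d) \<cdot> (?A (W a) (X b) (Y c) \<boxtimes> Id M (Z d))))"
    using X T by (simp add: ty linj_def rinj_def interchange_tail mult.assoc)
  finally have "?f \<cdot> (\<alpha> W (X \<odot> Y) Z g \<cdot> (?h \<cdot> ?q)) = ?r \<cdot> ((Id M (W a) \<boxtimes> ?A (X b) (Y c) (Z d)) \<cdot>
       (?A (W a) (X b \<otimes> Y c) (Z d) \<cdot> (?A (W a) (X b) (Y c) \<boxtimes> Id M (Z d))))"
    using X T g
    by (simp add: ty inj1[THEN Comp_eq_tail] interchange interchange_tail A3 mult.assoc[symmetric])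
  also have "\<dots> = ?r \<cdot> (?A (W a) (X b) (Y c \<otimes> Z d) \<cdot> ?A (W a \<otimes> X b) (Y c) (Z d))"
    using X pentagon by simp
  finally have lhs: "?f \<cdot> (\<alpha> W (X \<odot> Y) Z g \<cdot> (?h \<cdot> ?q)) = \<dots>" .
  have "\<alpha> (W \<odot> X) Y Z g \<cdot> ?q = rinj (W \<odot> X) Y Z (a * b) c d \<cdot>
      ((\<iota> W X a b \<boxtimes> Id M (Y c \<otimes> Z d)) \<cdot> ?A (W a \<otimes> X b) (Y c) (Z d))"
    using X T g by (simp add: ty A4[THEN Comp_eq_tail] Assoc_natural_Ar Tens_Id mult.assoc)
  \<comment> \<open>\<open>\<iota> W X a b\<close> and \<open>\<iota> Y Z c d\<close> act on
    different tensor factors, so interchange allows either to come first; the new order exposes the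
    \<open>linj\<close> of \<open>A5\<close>.\<close>
  also have "\<dots> = linj W X (Y \<odot> Z) a b (c * d) \<cdot>
      ((Id M (W a \<otimes> X b) \<boxtimes> \<iota> Y Z c d) \<cdot> ?A (W a \<otimes> X b) (Y c) (Z d))"
    using X T by (simp add: ty linj_def rinj_def interchange_tail mult.assoc)
  \<comment> \<open>Naturality of the associator concerns threefold tensor products of arrows, so
    the identity of \<open>W a \<otimes> X b\<close> is split into two identities.\<close>
  also have "\<dots> = linj W X (Y \<odot> Z) a b (c * d) \<cdot>
      (((Id M (W a) \<boxtimes> Id M (X b)) \<boxtimes> \<iota> Y Z c d) \<cdot> ?A (W a \<otimes> X b) (Y c) (Z d))"
    using X by (simp add: Tens_Id)
  finally have "\<alpha> W X (Y \<odot> Z) g \<cdot> (\<alpha> (W \<odot> X) Y Z g \<cdot> ?q) = rinj W X (Y \<odot> Z) a b (c * d) \<cdot>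
      ((Id M (W a) \<boxtimes> (Id M (X b) \<boxtimes> \<iota> Y Z c d)) \<cdot>
       (?A (W a) (X b) (Y c \<otimes> Z d) \<cdot> ?A (W a \<otimes> X b) (Y c) (Z d)))"
    using X T g
    by (simp add: ty A5[THEN Comp_eq_tail] Assoc_natural_Ar[THEN Comp_eq_tail] mult.assoc)
  also have "\<dots> = ?r \<cdot> (?A (W a) (X b) (Y c \<otimes> Z d) \<cdot> ?A (W a \<otimes> X b) (Y c) (Z d))"
    using X T by (simp add: ty rinj_def interchange_tail mult.assoc)
  finally have rhs: "\<alpha> W X (Y \<odot> Z) g \<cdot> (\<alpha> (W \<odot> X) Y Z g \<cdot> ?q) = \<dots>" .
  show "(?f \<cdot> (\<alpha> W (X \<odot> Y) Z g \<cdot> ?h)) \<cdot> ?q = (\<alpha> W X (Y \<odot> Z) g \<cdot> \<alpha> (W \<odot> X) Y Z g) \<cdot> ?q"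
  proof -
    have "?q \<in> Ar M" "Cod M ?q = (((W \<odot> X) \<odot> Y) \<odot> Z) g"
      using X T g by (simp_all add: ty)
    then show ?thesis
      using lhs rhs X T by (simp add: ty)
  qed
qed

section \<open>Assembly of the monoidal category\<close>

abbreviation graded :: "('g \<Rightarrow> 'o, 'g \<Rightarrow> 'm) premonoidal" where
  "graded \<equiv> graded_category M z cop inc"

lemma graded_simps [simp]:
  "Ob graded = {X. gobj X}" "Ar graded = {f. \<forall>g. f g \<in> Ar M}"
  "Dom graded f = (\<lambda>g. Dom M (f g))" "Cod graded f = (\<lambda>g. Cod M (f g))"
  "Id graded X = (\<lambda>g. Id M (X g))" "f \<cdot>\<^bsub>graded\<^esub> h = (\<lambda>g. f g \<cdot> h g)"
  "X \<otimes>\<^bsub>graded\<^esub> Y = X \<odot> Y" "f \<boxtimes>\<^bsub>graded\<^esub> h = f \<boxdot> h" "Unit graded = \<one>"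
  "Assoc graded = \<alpha>" "LUnit graded = lunit" "RUnit graded = runit"
  by (simp_all add: graded_category_def)

text \<open>\<open>Dom\<close> and \<open>Cod\<close> of a graded arrow are functions, and by
  extensionality their equality with \<open>X\<close> and \<open>Y\<close> is an equality in every
  degree. The categorical axioms thereby become families of statements about
  \<open>M\<close>.\<close>

lemma Hom_graded [simp]: "f \<in> Hom graded X Y \<longleftrightarrow> ghom X Y f"
  by (auto simp: Hom_iff fun_eq_iff)

lemma category_graded: "category graded"
  by unfold_locales
    (auto intro: Comp_Hom Id_Hom Dom_Ob Cod_Ob intro!: ext Comp_Id_left Comp_Id_right Comp_assoc)

lemma Iso_gradedI:
  assumes "\<And>g. f g \<in> Iso M (X g) (Y g)"
  shows "f \<in> Iso graded X Y"
proof -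
  have "\<exists>h. h \<in> Hom M (Y g) (X g) \<and> h \<cdot> f g = Id M (X g) \<and> f g \<cdot> h = Id M (Y g)" for g
    using Iso_inverse[OF assms] by metis
  then obtain h where "\<And>g. h g \<in> Hom M (Y g) (X g)" "\<And>g. h g \<cdot> f g = Id M (X g)"
      "\<And>g. f g \<cdot> h g = Id M (Y g)"
    by metis
  then show ?thesis
    using Iso_Hom[OF assms] by (intro category.IsoI[OF category_graded, of f X Y h]) (simp_all add: fun_eq_iff)
qed

lemma monoidal_category_graded: "monoidal_category graded"
proof -
  interpret category graded
    by (rule category_graded)
  have U: "gobj \<one>"
    using graded_unit_Ob by blast
  \<comment> \<open>The axioms on arrows supply only the arrows; the degreewise lemmas also ask for
    their sources and targets to be objects, which is recovered here.\<close>
  have H: "ghom X Y f \<Longrightarrow> gobj X \<and> gobj Y" for X Y f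
    using Hom_Ob[of f X Y] by simp
  show ?thesis
  proof (unfold_locales, goal_cases)
    case 1
    then show ?case using U by simp
  next
    case (2 X Y)
    then show ?case using gobj_tens by simp
  next
    case (3 f X X' h Y Y')
    then show ?case using ghom_tens H by simp
  next
    case (4 X Y)
    then show ?case using graded_tens_Id by auto
  next
    case (5 f X X' f' X'' h Y Y' h' Y'')
    then show ?case using graded_tens_Comp[of X X' X'' Y Y' Y'' f f' h h'] H by auto
  next
    case (6 X Y Z)
    then show ?case using graded_assoc_Iso by (auto intro!: Iso_gradedI)
  next
    case (7 f X X' h Y Y' k Z Z')
    then show ?case using graded_assoc_natural[of f X X' h Y Y' k Z Z'] H by auto
  next
    case (8 X)
    then show ?case using graded_lunit_spec by (auto intro!: Iso_gradedI)
  next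
    case (9 f X X')
    then show ?case using graded_lunit_natural[of f X X'] H by auto
  next
    case (10 X)
    then show ?case using graded_runit_spec by (auto intro!: Iso_gradedI)
  next
    case (11 f X X')
    then show ?case using graded_runit_natural[of f X X'] H by auto
  next
    case (12 X Y)
    then show ?case using graded_triangle by auto
  next
    case (13 W X Y Z)
    then show ?case using graded_pentagon by auto
  qed
qed

section \<open>Pre-duals\<close>

text \<open>Extending a family by \<open>z\<close> turns coproducts over \<open>{h. g * h = 1}\<close> into coproducts over
  \<open>factorizations 1\<close>, for which existence and compatibility with \<open>\<otimes>\<close> are assumed.\<close>

lemma right_inverses_coproduct_iff:
  fixes g :: 'g
  assumes "\<And>p. p \<in> factorizations 1 - {(a, b). a = g} \<Longrightarrow> is_initial M (X p)"
    and "\<And>p. p \<in> factorizations 1 - {(a, b). a = g} \<Longrightarrow> k p \<in> Hom M (X p) K"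
  shows "is_coproduct M (factorizations 1) X K k
    \<longleftrightarrow> is_coproduct M {h. g * h = 1} (\<lambda>h. X (g, h)) K (\<lambda>h. k (g, h))"
proof -
  \<comment> \<open>The row of \<open>factorizations 1\<close> with left entry \<open>g\<close>.
    \<open>Pair g\<close> and \<open>snd\<close> identify it with the right inverses of
    \<open>g\<close>; all other rows carry initial summands by assumption.\<close>
  let ?I = "{(a, b). a = g \<and> a * b = 1}"
  have sub: "?I \<subseteq> factorizations 1" "factorizations 1 - ?I = factorizations 1 - {(a, b). a = g}"
    by (auto simp: factorizations_def)
  have "bij_betw snd ?I {h. g * h = 1}" "bij_betw (Pair g) {h. g * h = 1} ?I"
    by (auto simp: bij_betw_def inj_on_def image_iff)
  then have "is_coproduct M ?I X K k
      \<longleftrightarrow> is_coproduct M {h. g * h = 1} (\<lambda>h. X (g, h)) K (\<lambda>h. k (g, h))"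
    using coproduct_reindex[of "{h. g * h = 1}" "\<lambda>h. X (g, h)" K "\<lambda>h. k (g, h)" snd ?I]
      coproduct_reindex[of ?I X K k "Pair g" "{h. g * h = 1}"]
      coproduct_cong[of ?I "\<lambda>i. X (g, snd i)" K "\<lambda>i. k (g, snd i)" X k]
    by auto
  moreover have "is_coproduct M (factorizations 1) X K k \<longleftrightarrow> is_coproduct M ?I X K k"
    using coproduct_restrict[of "factorizations 1" X K k ?I]
      coproduct_extend[of ?I X K k "factorizations 1"] sub assms by auto
  ultimately show ?thesis
    by simp
qed

lemma right_inverses_coproduct_exists:
  fixes X :: "'g \<Rightarrow> 'o"
  assumes "gobj X"
  shows "\<exists>K k. is_coproduct M {h. g * h = 1} X K k"
proof -
  let ?X = "\<lambda>(a, b). if a = g then X b else z"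
  have "\<forall>p \<in> factorizations 1. ?X p \<in> Ob M"
    using assms z_Ob by auto
  from chosen_coproduct[OF this]
  have cop: "is_coproduct M (factorizations 1) ?X (cop 1 ?X) (inc 1 ?X)" .
  have "is_coproduct M {h. g * h = 1} (\<lambda>h. ?X (g, h)) (cop 1 ?X) (\<lambda>h. inc 1 ?X (g, h))"
    using cop coproduct_inj[OF cop] initial_z
    by (subst right_inverses_coproduct_iff[symmetric]) auto
  then show ?thesis
    by auto
qed

text \<open>The family is padded, tensored and cut back. Padding needs legs from \<open>z\<close>
  into \<open>K\<close>, for which \<open>e\<close> is the only candidate; cutting back is allowed
  because \<open>Y \<otimes> z\<close> is again initial.\<close>

lemma right_inverses_coproduct_tens:
  fixes g :: 'g
  assumes cop: "is_coproduct M {h. g * h = 1} X K k" and Y: "Y \<in> Ob M"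
  shows "is_coproduct M {h. g * h = 1} (\<lambda>h. Y \<otimes> X h) (Y \<otimes> K) (\<lambda>h. Id M Y \<boxtimes> k h)"
proof -
  obtain e where e: "e \<in> Hom M z K"
    using initial_z coproduct_Ob[OF cop] by (auto simp: is_initial_def)
  let ?X = "\<lambda>(a, b). if a = g then X b else z"
  let ?k = "\<lambda>(a, b). if a = g then k b else e"
  have "is_coproduct M (factorizations 1) ?X K ?k"
    using cop e initial_z by (subst right_inverses_coproduct_iff[of g]) auto
  from coproduct_tens_left[OF this Y]
  have cop': "is_coproduct M (factorizations 1) (\<lambda>p. Y \<otimes> ?X p) (Y \<otimes> K) (\<lambda>p. Id M Y \<boxtimes> ?k p)" .
  have "is_coproduct M {h. g * h = 1} (\<lambda>h. Y \<otimes> ?X (g, h)) (Y \<otimes> K) (\<lambda>h. Id M Y \<boxtimes> ?k (g, h))"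
    using cop' coproduct_inj[OF cop'] initial_tens_z(1)[OF Y]
    by (subst right_inverses_coproduct_iff[symmetric]) auto
  then show ?thesis
    by simp
qed

text \<open>The coproducts \<open>K g\<close> and the pre-duals \<open>D g\<close> are arbitrary, so
  the explicit description holds for every choice of them, and mere existence follows by making one
  choice.\<close>

lemma graded_predual:
  assumes terminal: "is_terminal M z" and X: "gobj X"
    and cop: "\<And>g. is_coproduct M {h. g * h = 1} X (K g) (k g)"
    and predual: "\<And>g. is_predual M (K g) (D g) (ev g)"
  shows "\<exists>ev'. is_predual graded X D ev'"
proof -
  have K: "gobj K"
    using coproduct_Ob[OF cop] by blast
  have D: "gobj D" and ev: "\<And>g. ev g \<in> Hom M (D g \<otimes> K g) (Unit M)"
    using predual by (auto simp: is_predual_def)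
  have bij: "bij_betw (\<lambda>u. ev g \<cdot> (u \<boxtimes> Id M (K g))) (Hom M T (D g)) (Hom M (T \<otimes> K g) (Unit M))"
    if "T \<in> Ob M" for g T
    using predual that by (auto simp: is_predual_def)
  have kty: "k a b \<in> Ar M" "Dom M (k a b) = X b" "Cod M (k a b) = K a" if "a * b = 1" for a b
    using coproduct_inj[OF cop, of b a] that by (auto simp: Hom_iff)
  have evty: "ev g \<in> Ar M" "Dom M (ev g) = D g \<otimes> K g" "Cod M (ev g) = Unit M" for g
    using ev by (auto simp: Hom_iff)
  have U1: "\<one> 1 = Unit M"
    by (simp add: graded_unit_def)
  \<comment> \<open>Evaluation of \<open>D a\<close> on the summand \<open>X b\<close> of
    \<open>K a\<close>. Over all \<open>a * b = 1\<close> these arrows glue to the degree 1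
    component of the evaluation.\<close>
  let ?e = "\<lambda>(a, b). ev a \<cdot> (Id M (D a) \<boxtimes> k a b)"
  have "?e p \<in> Hom M (case p of (a, b) \<Rightarrow> D a \<otimes> X b) (Unit M)" if "p \<in> factorizations 1" for p
    using that X D K by (auto simp: factorizations_def Hom_iff typing kty evty)
  then obtain e1 where e1: "e1 \<in> Hom M ((D \<odot> X) 1) (Unit M)"
      and "\<And>p. p \<in> factorizations 1 \<Longrightarrow> e1 \<cdot> (case p of (a, b) \<Rightarrow> \<iota> D X a b) = ?e p"
    using coproduct_factor[OF graded_coproduct[OF D X] Unit_Ob, of 1 ?e] by blast
  then have e1_inj: "e1 \<cdot> \<iota> D X a b = ev a \<cdot> (Id M (D a) \<boxtimes> k a b)" if "a * b = 1" for a b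
    using that by (force simp: factorizations_def)
  \<comment> \<open>Outside degree 1 the graded unit is the terminal object \<open>z\<close>, so
    this component is forced.\<close>
  define ev' where "ev' g = (if g = 1 then e1 else THE u. u \<in> Hom M ((D \<odot> X) g) z)" for g
  have "ev' g \<in> Hom M ((D \<odot> X) g) (\<one> g)" for g
  proof (cases "g = 1")
    case False
    have "\<exists>!u. u \<in> Hom M ((D \<odot> X) g) z"
      using terminal graded_tens_Ob[OF D X] by (auto simp: is_terminal_def)
    then show ?thesis
      using theI'[of "\<lambda>u. u \<in> Hom M ((D \<odot> X) g) z"] False by (simp add: ev'_def graded_unit_def)
  qed (use e1 U1 in \<open>simp add: ev'_def\<close>)
  then have ev': "ghom (D \<odot> X) \<one> ev'"
    by blast
  \<comment> \<open>The bridge between evaluation in the graded category and in \<open>M\<close>: by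
    interchange, both sides equal \<open>ev a \<cdot> (u a \<boxtimes> k a b)\<close>. Injectivity
    and surjectivity are reduced through it to the bijections for the \<open>K a\<close>.\<close>
  have key: "(ev' 1 \<cdot> (u \<boxdot> (\<lambda>g. Id M (X g))) 1) \<cdot> \<iota> T X a b
      = (ev a \<cdot> (u a \<boxtimes> Id M (K a))) \<cdot> (Id M (T a) \<boxtimes> k a b)"
    if T: "gobj T" and u: "ghom T D u" and ab: "a * b = 1" for T u a b
  proof -
    note ty = graded_tens_ar_typing[OF u ghom_Id[OF X]] ghom_typing[OF u] ghom_typing[OF ev'] graded_typing
    have "ev' 1 \<cdot> \<iota> D X a b = ev a \<cdot> (Id M (D a) \<boxtimes> k a b)"
      using e1_inj[OF ab] by (simp add: ev'_def)
    from this[THEN Comp_eq_tail] show ?thesis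
      using T D X K ab graded_tens_ar_inj[OF u ghom_Id[OF X] T X D X ab]
      by (simp add: ty evty kty interchange)
  qed
  have "bij_betw (\<lambda>u g. ev' g \<cdot> (u \<boxdot> (\<lambda>g. Id M (X g))) g) {u. ghom T D u} {w. ghom (T \<odot> X) \<one> w}"
    if T: "gobj T" for T
    unfolding bij_betw_def
  proof (intro conjI inj_onI equalityI subsetI)
    let ?\<Phi> = "\<lambda>u g. ev' g \<cdot> (u \<boxdot> (\<lambda>g. Id M (X g))) g"
    have \<Phi>: "ghom (T \<odot> X) \<one> (?\<Phi> u)" if "ghom T D u" for u
      using ghom_tens[OF that ghom_Id[OF X] T X D X] ev' Comp_Hom by blast
    note copT = right_inverses_coproduct_tens[OF cop]
    have evu: "ev a \<cdot> (u a \<boxtimes> Id M (K a)) \<in> Hom M (T a \<otimes> K a) (Unit M)" if "ghom T D u" for u a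
      using bij_betwE[OF bij] T that by blast
    show "w \<in> {w. ghom (T \<odot> X) \<one> w}" if "w \<in> ?\<Phi> ` {u. ghom T D u}" for w
      using that \<Phi> by blast
    \<comment> \<open>Degree 1 of the equality suffices: \<open>key\<close> turns it into agreement
      on all summands \<open>T a \<otimes> X b\<close> of \<open>T a \<otimes> K a\<close>, and
      injectivity in \<open>M\<close> then gives \<open>u a = v a\<close>.\<close>
    show "u = v" if "u \<in> {u. ghom T D u}" "v \<in> {u. ghom T D u}" and eq: "?\<Phi> u = ?\<Phi> v" for u v
    proof
      fix a
      have u: "ghom T D u" and v: "ghom T D v"
        using that by auto
      have "ev a \<cdot> (u a \<boxtimes> Id M (K a)) = ev a \<cdot> (v a \<boxtimes> Id M (K a))"
      proof (rule coproduct_ext[OF copT evu[OF u] evu[OF v]])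
        fix b assume "b \<in> {b. a * b = 1}"
        then have ab: "a * b = 1"
          by simp
        show "(ev a \<cdot> (u a \<boxtimes> Id M (K a))) \<cdot> (Id M (T a) \<boxtimes> k a b)
            = (ev a \<cdot> (v a \<boxtimes> Id M (K a))) \<cdot> (Id M (T a) \<boxtimes> k a b)"
          using key[OF T u ab] key[OF T v ab] fun_cong[OF eq, of 1] by simp
      qed (use T in blast)
      then show "u a = v a"
        using bij[of "T a" a] T u v by (auto simp: bij_betw_def dest: inj_onD)
    qed
    fix w assume "w \<in> {w. ghom (T \<odot> X) \<one> w}"
    then have w: "ghom (T \<odot> X) \<one> w"
      by simp
    \<comment> \<open>The restrictions of \<open>w 1\<close> to the summands with left degree
      \<open>a\<close> glue to an arrow out of \<open>T a \<otimes> K a\<close>; its preimage under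
      the bijection in \<open>M\<close> is the component at \<open>a\<close> of the desired preimage
      of \<open>w\<close>.\<close>
    have "\<exists>u. u \<in> Hom M (T a) (D a) \<and> (\<forall>b. a * b = 1 \<longrightarrow>
        (ev a \<cdot> (u \<boxtimes> Id M (K a))) \<cdot> (Id M (T a) \<boxtimes> k a b) = w 1 \<cdot> \<iota> T X a b)" for a
    proof -
      have "w 1 \<cdot> \<iota> T X a b \<in> Hom M (T a \<otimes> X b) (Unit M)" if "b \<in> {b. a * b = 1}" for b
        using that T X U1 by (simp add: Hom_iff ghom_typing[OF w] graded_typing)
      then obtain w' where w': "w' \<in> Hom M (T a \<otimes> K a) (Unit M)"
          "\<And>b. b \<in> {b. a * b = 1} \<Longrightarrow> w' \<cdot> (Id M (T a) \<boxtimes> k a b) = w 1 \<cdot> \<iota> T X a b"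
        using coproduct_factor[OF copT Unit_Ob, of "T a" a "\<lambda>b. w 1 \<cdot> \<iota> T X a b"] T by blast
      obtain u where "u \<in> Hom M (T a) (D a)" "w' = ev a \<cdot> (u \<boxtimes> Id M (K a))"
        using bij[of "T a" a] T w'(1) unfolding bij_betw_def by blast
      then show ?thesis
        using w'(2) by blast
    qed
    then obtain u where u: "ghom T D u" and eq: "\<And>a b. a * b = 1 \<Longrightarrow>
        (ev a \<cdot> (u a \<boxtimes> Id M (K a))) \<cdot> (Id M (T a) \<boxtimes> k a b) = w 1 \<cdot> \<iota> T X a b"
      by metis
    have "?\<Phi> u g = w g" for g
    proof (cases "g = 1")
      case True
      have "?\<Phi> u 1 = w 1"
      proof (rule graded_ext[OF T X])
        show "?\<Phi> u 1 \<in> Hom M ((T \<odot> X) 1) (\<one> 1)" "w 1 \<in> Hom M ((T \<odot> X) 1) (\<one> 1)"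
          using \<Phi>[OF u] w by auto
      qed (use key[OF T u] eq in simp)
      then show ?thesis
        using True by simp
    next
      case False
      \<comment> \<open>Away from degree 1 the two arrows have the same source and end in a terminal
        object.\<close>
      then have "\<one> g = z"
        by (simp add: graded_unit_def)
      then show ?thesis
        using terminal_ext[OF terminal] \<Phi>[OF u] w by metis
    qed
    then show "w \<in> ?\<Phi> ` {u. ghom T D u}"
      using u by (intro image_eqI[of _ _ u]) auto
  qed
  moreover have "Hom graded T V = {f. ghom T V f}" for T V
    by auto
  ultimately have "is_predual graded X D ev'"
    using D ev' by (simp add: is_predual_def)
  then show ?thesis
    by blast
qed

end

theorem proposition3p15:
  fixes M :: "('o, 'm) premonoidal"
    and z :: "'o"
    and cop :: "('g::monoid_mult, 'o) chosen_cop"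
    and inc :: "('g, 'o, 'm) chosen_inc"
  assumes "monoidal_category M"
    and "is_initial M z"
    and "\<And>g X. (\<forall>p \<in> factorizations g. X p \<in> Ob M) \<Longrightarrow>
           is_coproduct M (factorizations g) X (cop g X) (inc g X)"
    and "tensor_preserves_initial M"
    and "\<And>g::'g. tensor_preserves_coproducts M (factorizations g)"
    and "is_terminal M z"
    and "pre_rigid M"
  shows "pre_rigid (graded_category M z cop inc) \<and>
    (\<forall>X \<in> Ob (graded_category M z cop inc).
       (\<forall>g. \<exists>K \<iota>. is_coproduct M {h. g * h = 1} X K \<iota>) \<and>
       (\<forall>K \<iota> D ev.
          (\<forall>g. is_coproduct M {h. g * h = 1} X (K g) (\<iota> g) \<and> is_predual M (K g) (D g) (ev g)) \<longrightarrow>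
          (\<exists>ev'. is_predual (graded_category M z cop inc) X D ev')))"
proof -
  interpret M: monoidal_category M
    by fact
  interpret G: graded_setting M z cop inc
    by unfold_locales (fact assms)+
  have predual: "\<exists>ev'. is_predual G.graded X D ev'"
    if "X \<in> Ob G.graded" "\<And>g. is_coproduct M {h. g * h = 1} X (K g) (\<iota> g)"
      "\<And>g. is_predual M (K g) (D g) (ev g)" for X K \<iota> D ev
    using G.graded_predual[OF assms(6) _ that(2,3)] that(1) by simp
  have cop: "\<exists>K \<iota>. is_coproduct M {h. g * h = 1} X K \<iota>" if "X \<in> Ob G.graded" for X g
    using G.right_inverses_coproduct_exists that by simp
  have "\<exists>D ev. is_predual G.graded X D ev" if X: "X \<in> Ob G.graded" for X
  proof -
    \<comment> \<open>Coproducts, and below their pre-duals in \<open>M\<close>, are chosen in all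
      degrees at once; \<open>predual\<close> accepts any such choice.\<close>
    obtain K \<iota> where K: "\<And>g. is_coproduct M {h. g * h = 1} X (K g) (\<iota> g)"
      using cop[OF X] by metis
    have "\<exists>D ev. is_predual M (K g) D ev" for g
      using pre_rigid.has_predual[OF assms(7) M.coproduct_Ob[OF K]] .
    then obtain D ev where "\<And>g. is_predual M (K g) (D g) (ev g)"
      by metis
    with predual[OF X K] show ?thesis
      by blast
  qed
  then have "pre_rigid G.graded"
    by (intro pre_rigid.intro pre_rigid_axioms.intro G.monoidal_category_graded)
  then show ?thesis
    using cop predual by blast
qed

end
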